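(* Let $q,r\ge2$ be integers, let $o=o_1o_2$ and let $x=x_1x_2$ be a vertex of $\mathrm{DL}(q,r)$. Let $\mathfrak u_i=\mathfrak u(x_i)$, $\mathfrak d_i=\mathfrak d(x_i)$ ($i=1,2$) and $\mathfrak s=\mathfrak u_1+\mathfrak u_2$. If $1\le m<n$ and $m,n$ are relatively prime, then the spectral measure $\mu_{o,x}$ of simple random walk on $\mathrm{DL}(q,r)$ satisfies $$\mu_{o,x}(\{\lambda_{m,n}\})=\sum_{\ell=\max\{1,\lceil \mathfrak s/n\rceil\}}^{\infty}\frac{2r^{-\ell n}}{\ell n}\sum_{k=0}^{\ell n-\mathfrak s}C_{k,\,\ell n-\mathfrak s-k}\,(r/q)^{k+d(x_1,o_1)/2}\,\sin\Bigl((k+\mathfrak u_1)\tfrac{m}{n}\pi\Bigr)\sin\Bigl((k+\mathfrak d_1)\tfrac{m}{n}\pi\Bigr),$$ where $\lambda_{m,n}=\frac{2\sqrt{qr}}{q+r}\cos\frac mn\pi$ and $$C_{k_1,k_2}=\begin{cases}(q-1)(r-1),&k_1>0,\ k_2>0,\\-(r-1),&k_1=0,\ k_2>0,\\-(q-1),&k_1>0,\ k_2=0,\\1,&k_1=k_2=0.\end{cases}$$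
   Context: Trees. For an integer $p\ge2$, $\mathbb T_p$ is the homogeneous tree of degree $p+1$ with a chosen root $o$ and a chosen reference end $\omega$ (an end is an equivalence class of geodesic rays, two rays being equivalent if their supports have finite symmetric difference). For a vertex $x$, $\overline{x\,\omega}$ is the unique geodesic ray from $x$ representing $\omega$; for vertices $v,z$ the confluent $b=v\curlywedge z$ is defined by $\overline{v\,\omega}\cap\overline{z\,\omega}=\overline{b\,\omega}$. For a vertex $x$ put $\mathfrak u(x)=d(o,x\curlywedge o)$, $\mathfrak d(x)=d(x,x\curlywedge o)$, where $d$ is the graph distance, and $\mathfrak h(x)=\mathfrak d(x)-\mathfrak u(x)$ (Busemann function). Diestel-Leader graph. Let $\mathbb T^1=\mathbb T_q$, $\mathbb T^2=\mathbb T_r$ with roots $o_1,o_2$ and reference ends $\omega_1,\omega_2$. $\mathrm{DL}(q,r)$ has vertex set $\{x_1x_2\in\mathbb T_q\times\mathbb T_r:\mathfrak h(x_1)+\mathfrak h(x_2)=0\}$, with $x_1x_2\sim y_1y_2$ iff $x_1\sim y_1$ and $x_2\sim y_2$. It is $(q+r)$-regular. For $x=x_1x_2$ one has $\mathfrak u_1+\mathfrak u_2=\mathfrak d_1+\mathfrak d_2$ (so $\mathfrak s=(d(x_1,o_1)+d(x_2,o_2))/2$), where $\mathfrak u_i,\mathfrak d_i$ are computed in $\mathbb T^i$ with respect to $o_i,\omega_i$. Spectral measures. The simple random walk operator $Pf(x)=\frac1{q+r}\sum_{y\sim x}f(y)$ is self-adjoint on $\ell^2(\mathrm{DL}(q,r))$;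 $E$ denotes its resolution of the identity and $\mu_{x,y}(d\lambda)=\langle\delta_x,E(d\lambda)\delta_y\rangle$, a signed measure characterized by its moments $\int\lambda^N\,d\mu_{x,y}(\lambda)=p^{(N)}(x,y)$, $N\ge0$, where $p^{(N)}(x,y)$ are the matrix elements of $P^N$. $\lceil\cdot\rceil$ is the ceiling function. *)

theory Defs
  imports "HOL-Analysis.Analysis"
begin

section \<open>Homogeneous trees with a root and a reference end\<close>

text \<open>A graph is given by its adjacency relation; its vertex set is the whole type.\<close>

definition gdist :: "('a \<Rightarrow> 'a \<Rightarrow> bool) \<Rightarrow> 'a \<Rightarrow> 'a \<Rightarrow> nat" where
  "gdist T x y = (LEAST n. (T ^^ n) x y)"

definition is_tree :: "('a \<Rightarrow> 'a \<Rightarrow> bool) \<Rightarrow> bool" where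
  "is_tree T \<longleftrightarrow>
     (\<forall>x. \<not> T x x) \<and> (\<forall>x y. T x y \<longrightarrow> T y x) \<and>
     (\<forall>x y. T\<^sup>*\<^sup>* x y) \<and>
     \<not> (\<exists>xs. 3 \<le> length xs \<and> distinct xs \<and> successively T xs \<and> T (last xs) (hd xs))"

definition homogeneous_tree :: "nat \<Rightarrow> ('a \<Rightarrow> 'a \<Rightarrow> bool) \<Rightarrow> bool" where
  "homogeneous_tree p T \<longleftrightarrow> is_tree T \<and> (\<forall>x. card {y. T x y} = p + 1)"

definition geodesic_rays :: "('a \<Rightarrow> 'a \<Rightarrow> bool) \<Rightarrow> (nat \<Rightarrow> 'a) set" where
  "geodesic_rays T = {\<rho>. \<forall>i j. i \<le> j \<longrightarrow> gdist T (\<rho> i) (\<rho> j) = j - i}"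

definition ray_equiv :: "('a \<Rightarrow> 'a \<Rightarrow> bool) \<Rightarrow> ((nat \<Rightarrow> 'a) \<times> (nat \<Rightarrow> 'a)) set" where
  "ray_equiv T = {(\<rho>, \<sigma>). \<rho> \<in> geodesic_rays T \<and> \<sigma> \<in> geodesic_rays T \<and>
                          finite ((range \<rho> - range \<sigma>) \<union> (range \<sigma> - range \<rho>))}"

definition ends :: "('a \<Rightarrow> 'a \<Rightarrow> bool) \<Rightarrow> (nat \<Rightarrow> 'a) set set" where
  "ends T = geodesic_rays T // ray_equiv T"

text \<open>In a tree, every end has exactly one representative starting at a given vertex. It
  depends on the end alone, so the adjacency relation is not a parameter here.\<close>

definition ray_to :: "(nat \<Rightarrow> 'a) set \<Rightarrow> 'a \<Rightarrow> nat \<Rightarrow> 'a" where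
  "ray_to \<omega> x = (THE \<rho>. \<rho> \<in> \<omega> \<and> \<rho> 0 = x)"

definition confluent :: "(nat \<Rightarrow> 'a) set \<Rightarrow> 'a \<Rightarrow> 'a \<Rightarrow> 'a" where
  "confluent \<omega> v z =
     (THE b. range (ray_to \<omega> v) \<inter> range (ray_to \<omega> z) = range (ray_to \<omega> b))"

definition up :: "('a \<Rightarrow> 'a \<Rightarrow> bool) \<Rightarrow> 'a \<Rightarrow> (nat \<Rightarrow> 'a) set \<Rightarrow> 'a \<Rightarrow> nat" where
  "up T rt \<omega> x = gdist T rt (confluent \<omega> x rt)"

definition down :: "('a \<Rightarrow> 'a \<Rightarrow> bool) \<Rightarrow> 'a \<Rightarrow> (nat \<Rightarrow> 'a) set \<Rightarrow> 'a \<Rightarrow> nat" where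
  "down T rt \<omega> x = gdist T x (confluent \<omega> x rt)"

definition busemann :: "('a \<Rightarrow> 'a \<Rightarrow> bool) \<Rightarrow> 'a \<Rightarrow> (nat \<Rightarrow> 'a) set \<Rightarrow> 'a \<Rightarrow> int" where
  "busemann T rt \<omega> x = int (down T rt \<omega> x) - int (up T rt \<omega> x)"


section \<open>Diestel-Leader graphs and simple random walk\<close>

definition DL_verts ::
  "('a \<Rightarrow> 'a \<Rightarrow> bool) \<Rightarrow> 'a \<Rightarrow> (nat \<Rightarrow> 'a) set \<Rightarrow>
   ('b \<Rightarrow> 'b \<Rightarrow> bool) \<Rightarrow> 'b \<Rightarrow> (nat \<Rightarrow> 'b) set \<Rightarrow> ('a \<times> 'b) set" where
  "DL_verts T1 o1 \<omega>1 T2 o2 \<omega>2 =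
     {(x1, x2). busemann T1 o1 \<omega>1 x1 + busemann T2 o2 \<omega>2 x2 = 0}"

definition DL_adj ::
  "('a \<Rightarrow> 'a \<Rightarrow> bool) \<Rightarrow> ('b \<Rightarrow> 'b \<Rightarrow> bool) \<Rightarrow> 'a \<times> 'b \<Rightarrow> 'a \<times> 'b \<Rightarrow> bool" where
  "DL_adj T1 T2 x y \<longleftrightarrow> T1 (fst x) (fst y) \<and> T2 (snd x) (snd y)"

text \<open>Functions on a vertex set \<open>V\<close> are represented by functions on the whole type that vanish
  outside \<open>V\<close>; \<open>k\<close> is the degree of the regular graph.\<close>

definition srw_op ::
  "'v set \<Rightarrow> ('v \<Rightarrow> 'v \<Rightarrow> bool) \<Rightarrow> nat \<Rightarrow> ('v \<Rightarrow> complex) \<Rightarrow> 'v \<Rightarrow> complex" where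
  "srw_op V adj k f x =
     (if x \<in> V then (\<Sum>y | y \<in> V \<and> adj x y. f y) / of_nat k else 0)"


section \<open>Spectral measures on \<open>\<ell>\<^sup>2(V)\<close>\<close>

definition ell2 :: "'v set \<Rightarrow> ('v \<Rightarrow> complex) set" where
  "ell2 V = {f. (\<forall>x. x \<notin> V \<longrightarrow> f x = 0) \<and> (\<lambda>x. (cmod (f x))\<^sup>2) summable_on V}"

definition ell2_inner :: "'v set \<Rightarrow> ('v \<Rightarrow> complex) \<Rightarrow> ('v \<Rightarrow> complex) \<Rightarrow> complex" where
  "ell2_inner V f g = (\<Sum>\<^sub>\<infinity>x\<in>V. cnj (f x) * g x)"

definition delta :: "'v \<Rightarrow> 'v \<Rightarrow> complex" where
  "delta x = (\<lambda>y. if y = x then 1 else 0)"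

definition orthogonal_projection ::
  "'v set \<Rightarrow> (('v \<Rightarrow> complex) \<Rightarrow> ('v \<Rightarrow> complex)) \<Rightarrow> bool" where
  "orthogonal_projection V Q \<longleftrightarrow>
     (\<forall>f\<in>ell2 V. Q f \<in> ell2 V) \<and>
     (\<forall>f\<in>ell2 V. \<forall>g\<in>ell2 V. Q (\<lambda>x. f x + g x) = (\<lambda>x. Q f x + Q g x)) \<and>
     (\<forall>f\<in>ell2 V. \<forall>c. Q (\<lambda>x. c * f x) = (\<lambda>x. c * Q f x)) \<and>
     (\<forall>f\<in>ell2 V. Q (Q f) = Q f) \<and>
     (\<forall>f\<in>ell2 V. \<forall>g\<in>ell2 V. ell2_inner V (Q f) g = ell2_inner V f (Q g))"

definition projection_valued_measure ::
  "'v set \<Rightarrow> (real set \<Rightarrow> ('v \<Rightarrow> complex) \<Rightarrow> ('v \<Rightarrow> complex)) \<Rightarrow> bool" where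
  "projection_valued_measure V E \<longleftrightarrow>
     (\<forall>A\<in>sets borel. orthogonal_projection V (E A)) \<and>
     (\<forall>f\<in>ell2 V. E UNIV f = f) \<and>
     (\<forall>A\<in>sets borel. \<forall>B\<in>sets borel. \<forall>f\<in>ell2 V. E (A \<inter> B) f = E A (E B f)) \<and>
     (\<forall>A :: nat \<Rightarrow> real set. range A \<subseteq> sets borel \<longrightarrow> disjoint_family A \<longrightarrow>
        (\<forall>f\<in>ell2 V. \<forall>g\<in>ell2 V.
           (\<lambda>i. ell2_inner V f (E (A i) g)) sums ell2_inner V f (E (\<Union>i. A i) g)))"

definition spectral_measure ::
  "'v set \<Rightarrow> (real set \<Rightarrow> ('v \<Rightarrow> complex) \<Rightarrow> ('v \<Rightarrow> complex)) \<Rightarrow> 'v \<Rightarrow> 'v \<Rightarrow> real set \<Rightarrow> complex"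
  where "spectral_measure V E x y A = ell2_inner V (delta x) (E A (delta y))"

text \<open>The values \<open>\<langle>f, E(A) f\<rangle> = \<parallel>E(A) f\<parallel>\<^sup>2\<close> are nonnegative reals, so this is an ordinary finite
  Borel measure.\<close>

definition diagonal_measure ::
  "'v set \<Rightarrow> (real set \<Rightarrow> ('v \<Rightarrow> complex) \<Rightarrow> ('v \<Rightarrow> complex)) \<Rightarrow> ('v \<Rightarrow> complex) \<Rightarrow> real measure" where
  "diagonal_measure V E f =
     measure_of UNIV (sets borel) (\<lambda>A. ennreal (Re (ell2_inner V f (E A f))))"

text \<open>\<open>E\<close> is the resolution of the identity of the bounded operator \<open>T\<close>, i.e.
  \<open>T = \<integral> \<lambda> E(d\<lambda>)\<close>. By polarization it suffices to require this on the diagonal, which avoids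
  integrating against complex measures.\<close>

definition resolution_of_identity ::
  "'v set \<Rightarrow> (('v \<Rightarrow> complex) \<Rightarrow> ('v \<Rightarrow> complex)) \<Rightarrow>
   (real set \<Rightarrow> ('v \<Rightarrow> complex) \<Rightarrow> ('v \<Rightarrow> complex)) \<Rightarrow> bool" where
  "resolution_of_identity V T E \<longleftrightarrow>
     projection_valued_measure V E \<and>
     (\<forall>f\<in>ell2 V. integrable (diagonal_measure V E f) (\<lambda>t. t) \<and>
        ell2_inner V f (T f) = complex_of_real (integral\<^sup>L (diagonal_measure V E f) (\<lambda>t. t)))"


section \<open>The quantities in the formula for the point masses\<close>

definition C_coeff :: "nat \<Rightarrow> nat \<Rightarrow> nat \<Rightarrow> nat \<Rightarrow> real" where
  "C_coeff q r k1 k2 =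
     (if k1 > 0 \<and> k2 > 0 then (real q - 1) * (real r - 1)
      else if k2 > 0 then - (real r - 1)
      else if k1 > 0 then - (real q - 1)
      else 1)"

definition lambda_mn :: "nat \<Rightarrow> nat \<Rightarrow> nat \<Rightarrow> nat \<Rightarrow> real" where
  "lambda_mn q r m n =
     2 * sqrt (real q * real r) / (real q + real r) * cos (real m / real n * pi)"

end

theory Submission
  imports Defs
begin

text \<open>
  The simple random walk on a Diestel-Leader graph has so many finitely supported eigenfunctions that
  their span is dense in \<open>\<ell>\<^sup>2\<close>, and the mass of the spectral measure at a point is read off from the expansion of
  \<open>\<delta>\<^sub>x\<close> in these eigenfunctions.

  Seen from its reference end, a homogeneous tree is a genealogy in which every vertex has one parent
  and \<open>p\<close> children (\<open>homogeneous_tree_genealogy\<close>). A step of the walk goes to a child in one tree and to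
  the parent in the other. Choose a vertex in each tree, as apexes, such that the points of the graph
  below both have distances \<open>k\<close> and \<open>N - k\<close> to them. On this finite set consider products of a function
  of the branch in the first tree, a function of the branch in the second tree and a profile \<open>g k\<close>,
  where both branch functions have sum zero. Contributions to points outside the set cancel because of
  the zero sums, and inside it the walk acts on \<open>g\<close> as a tridiagonal matrix with zero boundary values at
  \<open>k = 0\<close> and \<open>k = N\<close> (\<open>walk_block\<close>). Its eigenvectors are weighted sine waves, with eigenvalues
  \<open>lambda_mn q r l N\<close> for \<open>0 < l < N\<close>.

  Let \<open>A i\<close> be the average over the vertices of the first tree with the same \<open>i\<close>-th ancestor, and \<open>B j\<close>
  the same for the second tree. The expansion
  \<open>\<delta>\<^sub>x = (\<Sum>i j. (A i - A (Suc i)) (B j - B (Suc j)) \<delta>\<^sub>x)\<close> telescopes, with remainders of exponentially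
  small norm, and each of its terms lies in one of the spaces above, with apexes among the ancestors of
  \<open>x\<close> (\<open>delta_decomposition\<close>). The orthogonality of the sines expands such a term in eigenfunctions; the
  spectral projection at \<open>lambda_mn q r m n\<close> keeps the one with \<open>l / N = m / n\<close>, which exists exactly if
  \<open>n\<close> divides \<open>N\<close> (\<open>E_piece\<close>). Its value at \<open>o\<close> is nonzero only if the apexes are common ancestors, and
  it depends on whether \<open>o\<close> and \<open>x\<close> lie in the same branches below the apexes, which produces the four
  cases of \<open>C_coeff\<close> (\<open>block_at_confluent\<close>). Summing over all pairs of apexes, grouped by \<open>N = l n\<close>, gives
  the formula.

  The abstract resolution of the identity enters through one fact: \<open>E {\<mu>}\<close> fixes every eigenvector
  with eigenvalue \<open>\<mu>\<close> and annihilates all others (\<open>eigenvector_E\<close>). It is derived from the first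
  moments of the diagonal measures alone.
\<close>

section \<open>Homogeneous trees as genealogies\<close>

text \<open>Acyclicity is phrased through lists of distinct vertices, so connecting walks have to be
  shortened to such lists.\<close>

lemma rtranclp_simple_path:
  assumes "R\<^sup>*\<^sup>* a b"
  shows "\<exists>xs. xs \<noteq> [] \<and> hd xs = a \<and> last xs = b \<and> distinct xs \<and> successively R xs \<and>
              (\<forall>z\<in>set xs. R\<^sup>*\<^sup>* a z)"
  using assms
proof (induction rule: rtranclp_induct)
  case base
  show ?case by (rule exI[of _ "[a]"]) auto
next
  case (step b c)
  then obtain xs where xs: "xs \<noteq> []" "hd xs = a" "last xs = b" "distinct xs" "successively R xs"
    "\<forall>z\<in>set xs. R\<^sup>*\<^sup>* a z" by blast
  show ?case
  proof (cases "c \<in> set xs")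
    case True
    then obtain ys zs where "xs = ys @ c # zs" by (meson split_list)
    then show ?thesis
      using xs by (intro exI[of _ "ys @ [c]"])
        (auto simp: successively_append_iff hd_append split: if_splits)
  next
    case False
    have "R\<^sup>*\<^sup>* a c" using step by auto
    with False show ?thesis
      using xs step by (intro exI[of _ "xs @ [c]"]) (auto simp: successively_append_iff)
  qed
qed

locale tree =
  fixes T :: "'a \<Rightarrow> 'a \<Rightarrow> bool"
  assumes is_tree: "is_tree T"
begin

abbreviation dst :: "'a \<Rightarrow> 'a \<Rightarrow> nat" where
  "dst \<equiv> gdist T"

lemma adj_irrefl: "\<not> T x x" and adj_sym: "T x y \<Longrightarrow> T y x" and adj_connected: "T\<^sup>*\<^sup>* x y"
  using is_tree unfolding is_tree_def by blast+

lemma no_cycle: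
  "3 \<le> length xs \<Longrightarrow> distinct xs \<Longrightarrow> successively T xs \<Longrightarrow> \<not> T (last xs) (hd xs)"
  using is_tree unfolding is_tree_def by blast

lemma walk_gdist: "(T ^^ dst x y) x y"
  unfolding gdist_def using rtranclp_imp_relpowp[OF adj_connected] by (rule LeastI_ex)

lemma gdist_le: "(T ^^ n) x y \<Longrightarrow> dst x y \<le> n"
  unfolding gdist_def by (rule Least_le)

lemma gdist_refl [simp]: "dst x x = 0"
  using gdist_le[of 0 x x] by simp

lemma gdist_eq_0 [simp]: "dst x y = 0 \<longleftrightarrow> x = y"
  using walk_gdist[of x y] by auto

lemma gdist_triangle: "dst x z \<le> dst x y + dst y z"
  by (rule gdist_le[OF relpowp_trans[OF walk_gdist walk_gdist]])

lemma gdist_adj: "T x y \<Longrightarrow> dst x y = 1"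
  using gdist_le[of 1 x y] adj_irrefl gdist_eq_0[of x y] by (auto simp: le_Suc_eq)

lemma gdist_eq_1: "dst x y = 1 \<Longrightarrow> T x y"
  using walk_gdist[of x y] by (auto simp: eq_OO)

lemma closer_neighbour:
  assumes "x \<noteq> z"
  shows "\<exists>y. T x y \<and> dst x z = Suc (dst y z)"
proof -
  obtain n where n: "dst x z = Suc n"
    using assms gdist_eq_0 not0_implies_Suc by blast
  with walk_gdist[of x z] obtain y where y: "T x y" "(T ^^ n) y z"
    by (metis relpowp_Suc_D2)
  have "dst x z \<le> 1 + dst y z"
    using gdist_triangle[of x z y] gdist_adj[OF y(1)] by simp
  with gdist_le[OF y(2)] n y(1) show ?thesis by (intro exI[of _ y]) auto
qed

text \<open>Two neighbours of \<open>x\<close> that can both reach \<open>z\<close> without passing through \<open>x\<close> would close up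
  to a cycle through \<open>x\<close>; a geodesic that does not increase the distance to \<open>z\<close> avoids \<open>x\<close>.\<close>

lemma closer_neighbour_unique:
  assumes "T x y" "T x y'" "dst y z \<le> dst x z" "dst y' z \<le> dst x z"
  shows "y = y'"
proof (rule ccontr)
  assume neq: "y \<noteq> y'"
  define R where "R = (\<lambda>a b. T a b \<and> a \<noteq> x \<and> b \<noteq> x)"
  have reach: "R\<^sup>*\<^sup>* v z" if "v \<noteq> x" "dst v z \<le> dst x z" for v
    using that
  proof (induction "dst v z" arbitrary: v rule: less_induct)
    case (less v)
    show ?case
    proof (cases "v = z")
      case False
      then obtain w where w: "T v w" "dst v z = Suc (dst w z)"
        using closer_neighbour by blast
      then have "w \<noteq> x" "R v w" using less.prems by (auto simp: R_def)
      moreover from this w have "R\<^sup>*\<^sup>* w z" using less by auto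
      ultimately show ?thesis by (meson converse_rtranclp_into_rtranclp)
    qed auto
  qed
  have "symp R" using adj_sym by (auto simp: R_def symp_def)
  then have "symp R\<^sup>*\<^sup>*" by (simp add: symp_rtranclp)
  moreover have ne: "y \<noteq> x" "y' \<noteq> x" using assms adj_irrefl by auto
  ultimately have "R\<^sup>*\<^sup>* y y'"
    using reach[of y] reach[of y'] assms(3,4) by (meson rtranclp_trans sympD)
  from rtranclp_simple_path[OF this] obtain xs where xs: "xs \<noteq> []" "hd xs = y" "last xs = y'"
    "distinct xs" "successively R xs" "\<forall>v\<in>set xs. R\<^sup>*\<^sup>* y v" by blast
  have "v \<noteq> x" if "R\<^sup>*\<^sup>* y v" for v
    using that ne by (induction rule: rtranclp_induct) (auto simp: R_def)
  then have "x \<notin> set xs" using xs(6) by blast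
  moreover have "successively T xs"
    using xs(5) by (rule successively_mono) (auto simp: R_def)
  moreover have "2 \<le> length xs"
    using xs(1,2,3) neq by (cases xs rule: list.exhaust) (auto simp: Suc_le_eq split: if_splits)
  ultimately show False
    using no_cycle[of "x # xs"] xs assms(1,2) adj_sym by (auto simp: successively_Cons)
qed

lemma gdist_neighbours_neq:
  assumes "T x y"
  shows "dst y z \<noteq> dst x z"
proof
  assume eq: "dst y z = dst x z"
  show False
  proof (cases "x = z")
    case True
    then show False using eq assms adj_irrefl by auto
  next
    case False
    then obtain y' where "T x y'" "dst x z = Suc (dst y' z)"
      using closer_neighbour by blast
    then show False using closer_neighbour_unique[of x y y' z] assms eq by auto
  qed
qed

end

text \<open>Seen from an end, a homogeneous tree of degree \<open>p + 1\<close> is a genealogy: every vertex has one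
  parent, \<open>p\<close> children and a generation number, and any two vertices have a common ancestor.\<close>

locale genealogy =
  fixes p :: nat and par :: "'a \<Rightarrow> 'a" and h :: "'a \<Rightarrow> int"
  assumes p_ge: "2 \<le> p"
    and card_children: "card {y. par y = x} = p"
    and h_par: "h (par x) = h x - 1"
    and common_ancestor: "\<exists>k l. (par ^^ k) x = (par ^^ l) y"
begin

abbreviation anc :: "nat \<Rightarrow> 'a \<Rightarrow> 'a" where
  "anc k \<equiv> par ^^ k"

lemma anc_add: "anc (k + l) x = anc k (anc l x)"
  by (simp add: funpow_add)

lemma anc_par: "anc k (par x) = anc (Suc k) x"
  by (simp add: funpow_swap1)

lemma h_anc: "h (anc k x) = h x - int k"
  by (induction k) (auto simp: h_par)

lemma anc_eq_height: "anc k x = anc l y \<Longrightarrow> h x - int k = h y - int l"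
  by (metis h_anc)

lemma anc_eq_shift: "anc k x = anc l y \<Longrightarrow> anc (k + t) x = anc (l + t) y"
  by (simp add: add.commute[of _ t] anc_add)

text \<open>The lineages of two vertices agree from their first common ancestor on; the heights force the
  same shift along both lineages.\<close>

lemma confluence:
  obtains i j where "\<And>k l. anc k x = anc l y \<longleftrightarrow> (\<exists>t. k = i + t \<and> l = j + t)"
proof -
  define i where "i = (LEAST k. \<exists>l. anc k x = anc l y)"
  have "\<exists>l. anc i x = anc l y"
    unfolding i_def using common_ancestor by (rule LeastI_ex)
  then obtain j where j: "anc i x = anc j y" ..
  show ?thesis
  proof (rule that[of i j])
    fix k l
    show "anc k x = anc l y \<longleftrightarrow> (\<exists>t. k = i + t \<and> l = j + t)"
    proof
      assume eq: "anc k x = anc l y"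
      then have "i \<le> k" unfolding i_def by (blast intro: Least_le)
      then show "\<exists>t. k = i + t \<and> l = j + t"
        using anc_eq_height[OF eq] anc_eq_height[OF j] by (intro exI[of _ "k - i"]) auto
    qed (use anc_eq_shift[OF j] in auto)
  qed
qed

end


text \<open>Lower bound for the graph distance: one step of a walk changes the total number of
  generations from its ends up to their first common ancestor by at most one.\<close>

lemma (in genealogy) walk_imp_confluent:
  assumes adj: "\<And>x y. T x y \<longleftrightarrow> par x = y \<or> par y = x"
    and "(T ^^ n) x y"
  shows "\<exists>k l. anc k x = anc l y \<and> k + l \<le> n"
  using assms(2)
proof (induction n arbitrary: x)
  case 0
  then show ?case by (intro exI[of _ 0]) auto
next
  case (Suc n)
  then obtain w where w: "T x w" "(T ^^ n) w y" by (metis relpowp_Suc_D2)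
  then obtain k l where kl: "anc k w = anc l y" "k + l \<le> n" using Suc.IH by blast
  from w(1) consider "par x = w" | "par w = x" using adj by blast
  then show ?case
  proof cases
    case 1
    then show ?thesis using kl anc_par[of k x] by (intro exI[of _ "Suc k"] exI[of _ l]) auto
  next
    case 2
    show ?thesis
    proof (cases k)
      case 0
      then have "anc 0 x = anc (Suc l) y" using 2 kl by simp
      then show ?thesis using 0 kl by (intro exI[of _ 0] exI[of _ "Suc l"]) auto
    next
      case (Suc k')
      then have "anc k' x = anc l y" using 2 kl anc_par[of k' w] by simp
      then show ?thesis using Suc kl by (intro exI[of _ k'] exI[of _ l]) auto
    qed
  qed
qed

locale tree_with_ray = tree T for T :: "'a \<Rightarrow> 'a \<Rightarrow> bool" +
  fixes p :: nat and \<rho> :: "nat \<Rightarrow> 'a"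
  assumes card_nbrs: "card {y. T x y} = p + 1"
    and p_ge: "2 \<le> p"
    and ray: "\<rho> \<in> geodesic_rays T"
begin

definition D :: "nat \<Rightarrow> 'a \<Rightarrow> int" where
  "D j x = int (dst x (\<rho> j)) - int j"

text \<open>The Busemann function, as the eventual value of the nonincreasing sequence \<open>D j x\<close>; it is
  written as a least natural number, shifted by the lower bound \<open>- dst (\<rho> 0) x\<close>.\<close>

definition ht :: "'a \<Rightarrow> int" where
  "ht x = int (LEAST n. \<exists>j. int n = D j x + int (dst (\<rho> 0) x)) - int (dst (\<rho> 0) x)"

definition par :: "'a \<Rightarrow> 'a" where
  "par x = (THE y. T x y \<and> ht y = ht x - 1)"

lemma ray_dist: "i \<le> j \<Longrightarrow> dst (\<rho> i) (\<rho> j) = j - i"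
  using ray unfolding geodesic_rays_def by blast

lemma D_bound: "0 \<le> D j x + int (dst (\<rho> 0) x)"
  using gdist_triangle[of "\<rho> 0" "\<rho> j" x] ray_dist[of 0 j] by (simp add: D_def)

lemma D_antimono: "j \<le> j' \<Longrightarrow> D j' x \<le> D j x"
  using gdist_triangle[of x "\<rho> j'" "\<rho> j"] ray_dist[of j j'] by (simp add: D_def)

lemma ht_attained: "\<exists>j. D j x = ht x"
proof -
  have "\<exists>n. \<exists>j. int n = D j x + int (dst (\<rho> 0) x)"
    using D_bound[of 0 x] by (metis nonneg_int_cases)
  from LeastI_ex[OF this] show ?thesis unfolding ht_def by auto
qed

lemma ht_le: "ht x \<le> D j x"
proof -
  obtain n where n: "int n = D j x + int (dst (\<rho> 0) x)"
    using D_bound[of j x] by (metis nonneg_int_cases)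
  then have "(LEAST n. \<exists>j. int n = D j x + int (dst (\<rho> 0) x)) \<le> n"
    by (intro Least_le) auto
  then show ?thesis using n by (simp add: ht_def)
qed

lemma eventually_D: "eventually (\<lambda>j. D j x = ht x) sequentially"
proof -
  obtain J where "D J x = ht x" using ht_attained by blast
  then show ?thesis
    using D_antimono[of J _ x] ht_le[of x]
    by (intro eventually_sequentiallyI[of J]) (metis order_antisym)
qed

lemma eventually_D_nonzero: "eventually (\<lambda>j. x \<noteq> \<rho> j) sequentially"
proof -
  have "x \<noteq> \<rho> j" if "j > dst (\<rho> 0) x" for j
    using that ray_dist[of 0 j] by auto
  then show ?thesis by (intro eventually_sequentiallyI[of "Suc (dst (\<rho> 0) x)"]) auto
qed

lemma D_adj:
  assumes "T x y"
  shows "D j y = D j x + 1 \<or> D j y = D j x - 1"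
  using gdist_neighbours_neq[OF assms, of "\<rho> j"] gdist_triangle[of x "\<rho> j" y]
    gdist_triangle[of y "\<rho> j" x] gdist_adj[OF assms] gdist_adj[OF adj_sym[OF assms]]
  by (simp add: D_def) linarith

text \<open>Adjacent vertices never have the same distance to a third one, so neither can they have the
  same height.\<close>

lemma ht_adj:
  assumes "T x y"
  shows "ht y = ht x + 1 \<or> ht y = ht x - 1"
proof -
  have "eventually (\<lambda>j. ht y = ht x + 1 \<or> ht y = ht x - 1) sequentially"
    using eventually_D[of x] eventually_D[of y]
    by eventually_elim (use D_adj[OF assms] in metis)
  then show ?thesis by simp
qed

lemma parent_unique:
  assumes "T x y" "T x y'" "ht y = ht x - 1" "ht y' = ht x - 1"
  shows "y = y'"
proof -
  have "eventually (\<lambda>j. y = y') sequentially"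
    using eventually_D[of x] eventually_D[of y] eventually_D[of y']
  proof eventually_elim
    case (elim j)
    then show ?case
      using assms by (intro closer_neighbour_unique[of x y y' "\<rho> j"]) (auto simp: D_def)
  qed
  then show ?thesis by simp
qed

text \<open>Once \<open>D j x\<close> has reached its minimum, the geodesic from \<open>x\<close> to \<open>\<rho> j\<close> starts at the parent, and
  the minimum is attained at the same \<open>j\<close> there. So the lineage of \<open>x\<close> follows the geodesic until it
  meets the ray.\<close>

lemma parent_towards_ray:
  assumes "D j x = ht x" "x \<noteq> \<rho> j"
  shows "\<exists>y. T x y \<and> ht y = ht x - 1 \<and> D j y = ht y"
proof -
  obtain y where y: "T x y" "dst x (\<rho> j) = Suc (dst y (\<rho> j))"
    using closer_neighbour[OF assms(2)] by blast
  then have "D j y = ht x - 1" using assms(1) by (simp add: D_def)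
  moreover from this have "ht y \<le> ht x - 1" using ht_le[of y j] by simp
  with ht_adj[OF y(1)] have "ht y = ht x - 1" by auto
  ultimately show ?thesis using y(1) by auto
qed

lemma par_adj: "T x (par x)" and ht_par: "ht (par x) = ht x - 1"
proof -
  have "eventually (\<lambda>j. \<exists>y. T x y \<and> ht y = ht x - 1) sequentially"
    using eventually_D[of x] eventually_D_nonzero[of x]
    by eventually_elim (use parent_towards_ray in blast)
  then have "\<exists>y. T x y \<and> ht y = ht x - 1" by simp
  then have "\<exists>!y. T x y \<and> ht y = ht x - 1" using parent_unique by blast
  from theI'[OF this] have "T x (par x) \<and> ht (par x) = ht x - 1" unfolding par_def .
  then show "T x (par x)" "ht (par x) = ht x - 1" by auto
qed

lemma par_eqI: "T x y \<Longrightarrow> ht y = ht x - 1 \<Longrightarrow> par x = y"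
  using parent_unique[of x "par x" y] par_adj ht_par by blast

lemma adj_iff: "T x y \<longleftrightarrow> par x = y \<or> par y = x"
proof
  assume "T x y"
  then show "par x = y \<or> par y = x"
    using ht_adj[of x y] par_eqI[of x y] par_eqI[of y x] adj_sym by fastforce
qed (use par_adj adj_sym in blast)

lemma reaches_ray: "\<exists>k j. (par ^^ k) x = \<rho> j"
proof -
  obtain j where "D j x = ht x" using ht_attained by blast
  then have "\<exists>k. (par ^^ k) x = \<rho> j"
  proof (induction "dst x (\<rho> j)" arbitrary: x)
    case 0
    then show ?case by (intro exI[of _ 0]) auto
  next
    case (Suc d)
    then have "x \<noteq> \<rho> j" by auto
    from parent_towards_ray[OF Suc.prems this]
    obtain y where y: "T x y" "ht y = ht x - 1" "D j y = ht y" by blast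
    then have "d = dst y (\<rho> j)" using Suc by (simp add: D_def)
    from Suc.hyps(1)[OF this y(3)] obtain k where "(par ^^ k) y = \<rho> j" ..
    moreover have "par x = y" using par_eqI y by blast
    ultimately show ?case by (intro exI[of _ "Suc k"]) (simp add: funpow_swap1)
  qed
  then show ?thesis by blast
qed

lemma ht_ray: "ht (\<rho> j) = - int j"
proof -
  have "eventually (\<lambda>i. ht (\<rho> j) = - int j) sequentially"
    using eventually_D[of "\<rho> j"] eventually_ge_at_top[of j]
    by eventually_elim (simp add: D_def ray_dist)
  then show ?thesis by simp
qed

lemma par_ray: "par (\<rho> j) = \<rho> (Suc j)"
  by (rule par_eqI) (auto simp: ht_ray ray_dist intro: gdist_eq_1)

lemma anc_ray: "(par ^^ k) (\<rho> j) = \<rho> (j + k)"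
  by (induction k) (auto simp: par_ray)

sublocale genealogy p par ht
proof
  show "2 \<le> p" by (rule p_ge)
  show "ht (par x) = ht x - 1" for x by (rule ht_par)
  show "card {y. par y = x} = p" for x
  proof -
    have "finite {y. T x y}" using card_nbrs[of x] by (auto intro: card_ge_0_finite)
    moreover have "par (par x) \<noteq> x" using ht_par[of x] ht_par[of "par x"] by auto
    then have "{y. T x y} = insert (par x) {y. par y = x}" "par x \<notin> {y. par y = x}"
      using adj_iff by auto
    ultimately show ?thesis using card_nbrs[of x] by auto
  qed
  fix x y
  obtain k j where kj: "(par ^^ k) x = \<rho> j" using reaches_ray by blast
  obtain l i where li: "(par ^^ l) y = \<rho> i" using reaches_ray by blast
  have "(par ^^ (i + k)) x = (par ^^ (j + l)) y"
    by (simp add: funpow_add kj li anc_ray add.commute)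
  then show "\<exists>k l. (par ^^ k) x = (par ^^ l) y" by blast
qed

lemma walk_anc: "(T ^^ k) x (anc k x)"
proof (induction k)
  case (Suc k)
  then show ?case using par_adj[of "anc k x"] by auto
qed auto

lemma gdist_confluent:
  assumes ij: "\<And>k l. anc k x = anc l y \<longleftrightarrow> (\<exists>t. k = i + t \<and> l = j + t)"
  shows "dst x y = i + j"
proof (rule antisym)
  have "anc i x = anc j y" using ij by auto
  moreover have "dst (anc j y) y \<le> j"
  proof -
    have "(T ^^ j) a b \<Longrightarrow> (T ^^ j) b a" for a b j
    proof (induction j arbitrary: b)
      case (Suc j)
      then obtain c where "(T ^^ j) a c" "T c b" by auto
      then show ?case using Suc.IH adj_sym by (metis relpowp_Suc_I2)
    qed auto
    then show ?thesis using walk_anc gdist_le by blast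
  qed
  ultimately show "dst x y \<le> i + j"
    using gdist_triangle[of x y "anc i x"] gdist_le[OF walk_anc[of i x]] by simp
next
  from walk_imp_confluent[OF adj_iff walk_gdist] obtain k l
    where "anc k x = anc l y" "k + l \<le> dst x y" by blast
  then show "i + j \<le> dst x y" using ij by auto
qed

lemma anc_geodesic: "(\<lambda>k. anc k x) \<in> geodesic_rays T"
  unfolding geodesic_rays_def
proof (intro CollectI allI impI)
  fix i j :: nat assume "i \<le> j"
  have "anc k (anc i x) = anc l (anc j x) \<longleftrightarrow> (\<exists>t. k = (j - i) + t \<and> l = 0 + t)" for k l
  proof -
    have "anc k (anc i x) = anc l (anc j x) \<longleftrightarrow> k + i = l + j"
      using anc_eq_height[of "k + i" x "l + j" x] unfolding anc_add[symmetric] by auto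
    then show ?thesis using \<open>i \<le> j\<close> by (auto intro!: exI[of _ l])
  qed
  from gdist_confluent[OF this] show "dst (anc i x) (anc j x) = j - i" by simp
qed

lemma anc_in_end: "(\<lambda>k. anc k x) \<in> ray_equiv T `` {\<rho>}"
proof -
  obtain k j where kj: "anc k x = \<rho> j" using reaches_ray by blast
  have eq: "anc (i + k) x = \<rho> (j + i)" for i
    by (simp add: anc_add kj anc_ray)
  have "range \<rho> - range (\<lambda>k. anc k x) \<subseteq> \<rho> ` {..<j}"
  proof
    fix v assume v: "v \<in> range \<rho> - range (\<lambda>k. anc k x)"
    then obtain i where i: "v = \<rho> i" by blast
    have "\<not> j \<le> i" using eq[of "i - j"] v i by (metis DiffE le_add_diff_inverse rangeI)
    then show "v \<in> \<rho> ` {..<j}" using i by auto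
  qed
  moreover have "range (\<lambda>k. anc k x) - range \<rho> \<subseteq> (\<lambda>k. anc k x) ` {..<k}"
  proof
    fix v assume v: "v \<in> range (\<lambda>k. anc k x) - range \<rho>"
    then obtain i where i: "v = anc i x" by blast
    have "\<not> k \<le> i" using eq[of "i - k"] v i by (metis DiffE le_add_diff_inverse2 rangeI)
    then show "v \<in> (\<lambda>k. anc k x) ` {..<k}" using i by auto
  qed
  ultimately have "finite ((range \<rho> - range (\<lambda>k. anc k x)) \<union> (range (\<lambda>k. anc k x) - range \<rho>))"
    by (meson finite_UnI finite_imageI finite_lessThan finite_subset)
  then show ?thesis using ray anc_geodesic by (simp add: ray_equiv_def)
qed

text \<open>A geodesic that once steps from a parent to a child can never turn back, so it moves away
  from \<open>\<rho>\<close> for ever; a geodesic representing the end must therefore follow the parents.\<close>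

lemma end_ray_unique:
  assumes "\<sigma> \<in> ray_equiv T `` {\<rho>}"
  shows "\<sigma> = (\<lambda>k. anc k (\<sigma> 0))"
proof -
  have geo: "\<sigma> \<in> geodesic_rays T" and fin: "finite (range \<sigma> - range \<rho>)"
    using assms by (auto simp: ray_equiv_def)
  have dist: "dst (\<sigma> i) (\<sigma> j) = j - i" if "i \<le> j" for i j
    using geo that unfolding geodesic_rays_def by blast
  have step: "par (\<sigma> i) = \<sigma> (Suc i) \<or> par (\<sigma> (Suc i)) = \<sigma> i" for i
    using gdist_eq_1[of "\<sigma> i" "\<sigma> (Suc i)"] dist[of i "Suc i"] adj_iff by auto
  have "par (\<sigma> i) = \<sigma> (Suc i)" for i
  proof (rule ccontr)
    assume "par (\<sigma> i) \<noteq> \<sigma> (Suc i)"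
    then have start: "par (\<sigma> (Suc i)) = \<sigma> i" using step by blast
    have away: "par (\<sigma> (Suc (i + k))) = \<sigma> (i + k)" for k
    proof (induction k)
      case 0
      show ?case using start by simp
    next
      case (Suc k)
      show ?case
      proof (rule ccontr)
        assume "\<not> ?thesis"
        then have "par (\<sigma> (Suc (i + k))) = \<sigma> (Suc (Suc (i + k)))"
          using step[of "Suc (i + k)"] by simp
        then have "\<sigma> (i + k) = \<sigma> (Suc (Suc (i + k)))" using Suc by simp
        then show False using dist[of "i + k" "Suc (Suc (i + k))"] by simp
      qed
    qed
    have height: "ht (\<sigma> (i + k)) = ht (\<sigma> i) + int k" for k
      by (induction k) (use away ht_par in \<open>auto simp: algebra_simps\<close>, metis add_diff_cancel diff_add_eq)
    \<comment> \<open>After \<open>K\<close> more steps the heights are positive, while those of the ray \<open>\<rho>\<close> are not.\<close>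
    define K where "K = nat (1 - ht (\<sigma> i))"
    have "\<sigma> ` {i + K..} \<subseteq> range \<sigma> - range \<rho>"
    proof
      fix v assume "v \<in> \<sigma> ` {i + K..}"
      then obtain k where k: "v = \<sigma> (i + (K + k))"
        by (metis add.assoc atLeast_iff image_iff le_Suc_ex)
      have "ht v > 0" using height[of "K + k"] k by (simp add: K_def)
      then show "v \<in> range \<sigma> - range \<rho>" using k ht_ray by auto
    qed
    moreover have "inj \<sigma>"
    proof (rule injI)
      have "a = b" if "a \<le> b" "\<sigma> a = \<sigma> b" for a b
        using dist[OF that(1)] that by simp
      then show "a = b" if "\<sigma> a = \<sigma> b" for a b
        using that by (metis nat_le_linear)
    qed
    then have "infinite (\<sigma> ` {i + K..})"
      by (meson finite_imageD inj_on_subset infinite_Ici subset_UNIV)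
    ultimately show False using fin finite_subset by blast
  qed
  then have "\<sigma> (Suc i) = par (\<sigma> i)" for i by simp
  then have "\<sigma> k = anc k (\<sigma> 0)" for k by (induction k) simp_all
  then show ?thesis by blast
qed

lemma ray_to_end: "ray_to (ray_equiv T `` {\<rho>}) x = (\<lambda>k. anc k x)"
  unfolding ray_to_def
proof (rule the_equality)
  fix \<sigma> assume "\<sigma> \<in> ray_equiv T `` {\<rho>} \<and> \<sigma> 0 = x"
  then show "\<sigma> = (\<lambda>k. anc k x)" using end_ray_unique[of \<sigma>] by simp
qed (use anc_in_end in auto)

lemma confluent_end:
  assumes ij: "\<And>k l. anc k x = anc l y \<longleftrightarrow> (\<exists>t. k = i + t \<and> l = j + t)"
  shows "confluent (ray_equiv T `` {\<rho>}) x y = anc i x"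
  unfolding confluent_def ray_to_end
proof (rule the_equality)
  have top: "anc i x = anc j y" using ij by auto
  show *: "range (\<lambda>k. anc k x) \<inter> range (\<lambda>k. anc k y) = range (\<lambda>k. anc k (anc i x))"
  proof (intro equalityI subsetI)
    fix v assume "v \<in> range (\<lambda>k. anc k x) \<inter> range (\<lambda>k. anc k y)"
    then obtain k l where kl: "v = anc k x" "v = anc l y" by blast
    then obtain t where "k = i + t" using ij by metis
    then have "v = anc t (anc i x)" using kl by (simp add: anc_add[symmetric] add.commute)
    then show "v \<in> range (\<lambda>k. anc k (anc i x))" by blast
  next
    fix v assume "v \<in> range (\<lambda>k. anc k (anc i x))"
    then obtain t where t: "v = anc t (anc i x)" by blast
    then have "v = anc (t + i) x" "v = anc (t + j) y" by (simp_all add: anc_add top)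
    then show "v \<in> range (\<lambda>k. anc k x) \<inter> range (\<lambda>k. anc k y)" by blast
  qed
  fix b assume "range (\<lambda>k. anc k x) \<inter> range (\<lambda>k. anc k y) = range (\<lambda>k. anc k b)"
  then have eq: "range (\<lambda>k. anc k b) = range (\<lambda>k. anc k (anc i x))" using * by simp
  have "b \<in> range (\<lambda>k. anc k b)" "anc i x \<in> range (\<lambda>k. anc k (anc i x))"
    by (auto intro: range_eqI[of _ _ 0])
  then obtain k l where kl: "b = anc k (anc i x)" "anc i x = anc l b"
    using eq by blast
  from kl have "ht b = ht (anc i x) - int k" "ht (anc i x) = ht b - int l"
    using h_anc by metis+
  then have "k = 0" by linarith
  then show "b = anc i x" using kl by simp
qed

lemma up_down_end:
  assumes ij: "\<And>k l. anc k x = anc l y \<longleftrightarrow> (\<exists>t. k = i + t \<and> l = j + t)"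
  shows "down T y (ray_equiv T `` {\<rho>}) x = i" "up T y (ray_equiv T `` {\<rho>}) x = j"
proof -
  have top: "anc i x = anc j y" using ij by auto
  have "dst v (anc k v) = k" for k v
    using anc_geodesic[of v] unfolding geodesic_rays_def by (force dest: spec[of _ 0])
  then show "down T y (ray_equiv T `` {\<rho>}) x = i" "up T y (ray_equiv T `` {\<rho>}) x = j"
    unfolding down_def up_def confluent_end[OF ij] by (simp, simp add: top)
qed

end

text \<open>From here on the tree geometry is arithmetic of generations: the confluent is the first common
  ancestor, and \<open>down\<close> and \<open>up\<close> count the generations from the two vertices to it.\<close>

theorem homogeneous_tree_genealogy:
  assumes "homogeneous_tree p T" "2 \<le> p" "\<omega> \<in> ends T"
  obtains par h where
    "genealogy p par h"
    "\<And>x y. T x y \<longleftrightarrow> par x = y \<or> par y = x"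
    "\<And>x y k l. (par ^^ k) x = (par ^^ l) y \<longleftrightarrow>
        (\<exists>t. k = down T y \<omega> x + t \<and> l = up T y \<omega> x + t)"
    "\<And>x y. gdist T x y = down T y \<omega> x + up T y \<omega> x"
    "\<And>x y. busemann T y \<omega> x = h x - h y"
proof -
  obtain \<rho> where \<rho>: "\<rho> \<in> geodesic_rays T" "\<omega> = ray_equiv T `` {\<rho>}"
    using assms(3) unfolding ends_def by (elim quotientE) auto
  interpret tree_with_ray T p \<rho>
    using assms \<rho> by unfold_locales (auto simp: homogeneous_tree_def)
  have conf: "anc k x = anc l y \<longleftrightarrow> (\<exists>t. k = down T y \<omega> x + t \<and> l = up T y \<omega> x + t)" for x y k l
  proof -
    obtain i j where ij: "\<And>k l. anc k x = anc l y \<longleftrightarrow> (\<exists>t. k = i + t \<and> l = j + t)"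
      using confluence by blast
    then show ?thesis using up_down_end[OF ij] \<rho>(2) by simp
  qed
  show ?thesis
  proof (rule that[of par ht])
    show "genealogy p par ht" ..
    show "T x y \<longleftrightarrow> par x = y \<or> par y = x" for x y by (rule adj_iff)
    show "anc k x = anc l y \<longleftrightarrow> (\<exists>t. k = down T y \<omega> x + t \<and> l = up T y \<omega> x + t)" for x y k l
      by (rule conf)
    show "gdist T x y = down T y \<omega> x + up T y \<omega> x" for x y
      by (rule gdist_confluent[OF conf])
    show "busemann T y \<omega> x = ht x - ht y" for x y
      using anc_eq_height[of "down T y \<omega> x" x "up T y \<omega> x" y] conf[of "down T y \<omega> x" x "up T y \<omega> x" y]
      by (simp add: busemann_def)
  qed
qed

section \<open>The Hilbert space of square-summable functions\<close>

lemma ell2_0: "(\<lambda>x. 0) \<in> ell2 V"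
  by (simp add: ell2_def)

lemma ell2_scale: "f \<in> ell2 V \<Longrightarrow> (\<lambda>x. c * f x) \<in> ell2 V"
  by (auto simp: ell2_def norm_mult power_mult_distrib intro: summable_on_cmult_right)

lemma ell2_add:
  assumes "f \<in> ell2 V" "g \<in> ell2 V"
  shows "(\<lambda>x. f x + g x) \<in> ell2 V"
proof -
  have "(\<lambda>x. (cmod (f x + g x))\<^sup>2) summable_on V"
  proof (rule summable_on_comparison_test)
    show "(\<lambda>x. 2 * (cmod (f x))\<^sup>2 + 2 * (cmod (g x))\<^sup>2) summable_on V"
      using assms by (intro summable_on_add summable_on_cmult_right) (auto simp: ell2_def)
    fix x assume "x \<in> V"
    have "(cmod (f x + g x))\<^sup>2 \<le> (cmod (f x) + cmod (g x))\<^sup>2"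
      by (intro power_mono norm_triangle_ineq) auto
    also have "\<dots> \<le> 2 * (cmod (f x))\<^sup>2 + 2 * (cmod (g x))\<^sup>2"
      using zero_le_power2[of "cmod (f x) - cmod (g x)"] by (simp add: power2_eq_square algebra_simps)
    finally show "(cmod (f x + g x))\<^sup>2 \<le> 2 * (cmod (f x))\<^sup>2 + 2 * (cmod (g x))\<^sup>2" .
  qed auto
  then show ?thesis using assms by (auto simp: ell2_def)
qed

lemma ell2_sum:
  "finite I \<Longrightarrow> (\<And>i. i \<in> I \<Longrightarrow> f i \<in> ell2 V) \<Longrightarrow> (\<lambda>x. \<Sum>i\<in>I. f i x) \<in> ell2 V"
  by (induction I rule: finite_induct) (auto simp: ell2_0 ell2_add)

lemma ell2_finite_support:
  assumes "finite S" "S \<subseteq> V" "\<And>x. x \<notin> S \<Longrightarrow> f x = 0"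
  shows "f \<in> ell2 V"
proof -
  have "(\<lambda>x. (cmod (f x))\<^sup>2) summable_on S" using assms(1) by simp
  then have "(\<lambda>x. (cmod (f x))\<^sup>2) summable_on V"
    by (rule summable_on_cong_neutral[THEN iffD1, rotated -1]) (use assms in auto)
  then show ?thesis using assms by (auto simp: ell2_def)
qed

lemma ell2_inner_summable:
  assumes "f \<in> ell2 V" "g \<in> ell2 V"
  shows "(\<lambda>x. cnj (f x) * g x) summable_on V"
proof -
  have "(\<lambda>x. norm (cnj (f x) * g x)) summable_on V"
  proof (rule summable_on_comparison_test)
    show "(\<lambda>x. (cmod (f x))\<^sup>2 + (cmod (g x))\<^sup>2) summable_on V"
      using assms by (intro summable_on_add) (auto simp: ell2_def)
    fix x
    have "2 * (cmod (f x) * cmod (g x)) \<le> (cmod (f x))\<^sup>2 + (cmod (g x))\<^sup>2"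
      using zero_le_power2[of "cmod (f x) - cmod (g x)"] by (simp add: power2_eq_square algebra_simps)
    moreover have "0 \<le> cmod (f x) * cmod (g x)" by simp
    ultimately show "norm (cnj (f x) * g x) \<le> (cmod (f x))\<^sup>2 + (cmod (g x))\<^sup>2"
      by (simp only: norm_mult complex_mod_cnj)
  qed auto
  then show ?thesis by (rule abs_summable_summable)
qed

lemma ell2_inner_add_right:
  "f \<in> ell2 V \<Longrightarrow> g \<in> ell2 V \<Longrightarrow> h \<in> ell2 V \<Longrightarrow>
   ell2_inner V f (\<lambda>x. g x + h x) = ell2_inner V f g + ell2_inner V f h"
  unfolding ell2_inner_def by (simp add: ring_distribs infsum_add ell2_inner_summable)

lemma ell2_inner_scale_right: "ell2_inner V f (\<lambda>x. c * g x) = c * ell2_inner V f g"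
  unfolding ell2_inner_def by (simp add: mult.left_commute infsum_cmult_right')

lemma ell2_inner_add_left:
  "f \<in> ell2 V \<Longrightarrow> g \<in> ell2 V \<Longrightarrow> h \<in> ell2 V \<Longrightarrow>
   ell2_inner V (\<lambda>x. f x + g x) h = ell2_inner V f h + ell2_inner V g h"
  unfolding ell2_inner_def by (simp add: ring_distribs infsum_add ell2_inner_summable)

lemma ell2_inner_scale_left: "ell2_inner V (\<lambda>x. c * f x) g = cnj c * ell2_inner V f g"
  unfolding ell2_inner_def by (simp add: mult.assoc infsum_cmult_right')

lemma ell2_inner_self:
  assumes "f \<in> ell2 V"
  shows "ell2_inner V f f = of_real (\<Sum>\<^sub>\<infinity>x\<in>V. (cmod (f x))\<^sup>2)"
proof -
  have "cnj (f x) * f x = of_real ((cmod (f x))\<^sup>2)" for x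
    using complex_norm_square[of "f x"] by (simp add: mult.commute)
  moreover have "(\<lambda>x. (cmod (f x))\<^sup>2) summable_on V" using assms by (simp add: ell2_def)
  ultimately show ?thesis
    unfolding ell2_inner_def by (simp only: infsumI[OF has_sum_of_real[OF has_sum_infsum]])
qed

lemma ell2_inner_self_eq_0:
  assumes "f \<in> ell2 V" "ell2_inner V f f = 0"
  shows "f = (\<lambda>x. 0)"
proof
  fix x
  have "(\<Sum>\<^sub>\<infinity>x\<in>V. (cmod (f x))\<^sup>2) = 0"
    using assms(2) unfolding ell2_inner_self[OF assms(1)] of_real_eq_0_iff .
  then have "(cmod (f x))\<^sup>2 = 0" if "x \<in> V"
    using assms(1) that by (intro nonneg_infsum_le_0D[where A = V]) (auto simp: ell2_def)
  then show "f x = 0" using assms(1) by (cases "x \<in> V") (auto simp: ell2_def)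
qed

lemma delta_ell2: "v \<in> V \<Longrightarrow> delta v \<in> ell2 V"
  by (rule ell2_finite_support[of "{v}"]) (auto simp: delta_def)

lemma ell2_inner_delta:
  assumes "v \<in> V"
  shows "ell2_inner V (delta v) g = g v"
proof -
  have "ell2_inner V (delta v) g = (\<Sum>\<^sub>\<infinity>x\<in>{v}. cnj (delta v x) * g x)"
    unfolding ell2_inner_def by (rule infsum_cong_neutral) (use assms in \<open>auto simp: delta_def\<close>)
  then show ?thesis by (simp add: delta_def)
qed

text \<open>By Cauchy-Schwarz, uniform distributions on growing sets tend weakly to zero.\<close>

lemma ell2_inner_uniform_bound:
  assumes u: "u \<in> ell2 V" and S: "finite S" "S \<subseteq> V"
  shows "(cmod (ell2_inner V u (\<lambda>y. of_bool (y \<in> S) / of_nat (card S))))\<^sup>2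
    \<le> (\<Sum>\<^sub>\<infinity>y\<in>V. (cmod (u y))\<^sup>2) / real (card S)"
proof (cases "S = {}")
  case False
  let ?U = "\<Sum>\<^sub>\<infinity>y\<in>V. (cmod (u y))\<^sup>2" and ?n = "real (card S)"
  have n: "?n > 0" using False S by (simp add: card_gt_0_iff)
  have "ell2_inner V u (\<lambda>y. of_bool (y \<in> S) / of_nat (card S))
      = (\<Sum>\<^sub>\<infinity>y\<in>S. cnj (u y) / of_nat (card S))"
    unfolding ell2_inner_def by (rule infsum_cong_neutral) (use S in auto)
  also have "\<dots> = (\<Sum>y\<in>S. cnj (u y)) / of_nat (card S)"
    using S by (simp add: sum_divide_distrib)
  finally have "cmod (ell2_inner V u (\<lambda>y. of_bool (y \<in> S) / of_nat (card S)))
      = cmod (\<Sum>y\<in>S. cnj (u y)) / ?n" by (simp add: norm_divide)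
  also have "\<dots> \<le> (\<Sum>y\<in>S. cmod (u y)) / ?n"
    using norm_sum[of "\<lambda>y. cnj (u y)" S] by (intro divide_right_mono) auto
  finally have "(cmod (ell2_inner V u (\<lambda>y. of_bool (y \<in> S) / of_nat (card S))))\<^sup>2
      \<le> ((\<Sum>y\<in>S. cmod (u y)) / ?n)\<^sup>2" by (rule power_mono) simp
  also have "\<dots> \<le> ?U * ?n / ?n\<^sup>2"
  proof -
    have "(\<Sum>y\<in>S. cmod (u y))\<^sup>2 \<le> (\<Sum>y\<in>S. (cmod (u y))\<^sup>2) * ?n"
      by (rule sum_squared_le_sum_of_squares)
    also have "\<dots> \<le> ?U * ?n"
      using u S by (intro mult_right_mono finite_sum_le_infsum) (auto simp: ell2_def)
    finally show ?thesis by (simp add: power_divide divide_right_mono)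
  qed
  also have "\<dots> = ?U / ?n" using n by (simp add: power2_eq_square)
  finally show ?thesis .
qed (simp add: ell2_inner_def)

text \<open>Cauchy-Schwarz at every vertex, followed by an exchange of sums along the edges: each value
  \<open>f y\<close> is used by at most \<open>D\<close> neighbours.\<close>

lemma srw_op_ell2:
  assumes sym: "\<And>x y. adj x y \<Longrightarrow> adj y x"
    and fin: "\<And>x. finite {y. adj x y}" and deg: "\<And>x. card {y. adj x y} \<le> D"
    and f: "f \<in> ell2 V"
  shows "srw_op V adj k f \<in> ell2 V"
proof -
  define N where "N = (\<lambda>x. {y. y \<in> V \<and> adj x y})"
  define U where "U = (\<Sum>\<^sub>\<infinity>y\<in>V. (cmod (f y))\<^sup>2)"
  have N: "finite (N x)" "card (N x) \<le> D" for x
    using fin[of x] deg[of x] card_mono[OF fin[of x], of "N x"] finite_subset[OF _ fin[of x], of "N x"]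
    by (auto simp: N_def intro: order_trans)
  have fsum: "(\<lambda>y. (cmod (f y))\<^sup>2) summable_on V" using f by (simp add: ell2_def)
  have pointwise: "(cmod (srw_op V adj k f x))\<^sup>2 \<le> real D * (\<Sum>y\<in>N x. (cmod (f y))\<^sup>2)" for x
  proof (cases "x \<in> V")
    case True
    have "cmod (srw_op V adj k f x) = cmod (\<Sum>y\<in>N x. f y) / real k"
      using True by (simp add: srw_op_def N_def norm_divide)
    also have "\<dots> \<le> cmod (\<Sum>y\<in>N x. f y)"
      by (cases "k = 0") (auto simp: divide_le_eq mult_le_cancel_left1)
    also have "\<dots> \<le> (\<Sum>y\<in>N x. cmod (f y))" by (rule norm_sum)
    finally have "(cmod (srw_op V adj k f x))\<^sup>2 \<le> (\<Sum>y\<in>N x. cmod (f y))\<^sup>2"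
      by (rule power_mono) simp
    also have "\<dots> \<le> (\<Sum>y\<in>N x. (cmod (f y))\<^sup>2) * real (card (N x))"
      by (rule sum_squared_le_sum_of_squares)
    also have "\<dots> \<le> (\<Sum>y\<in>N x. (cmod (f y))\<^sup>2) * real D"
      using N by (intro mult_left_mono sum_nonneg) auto
    finally show ?thesis by (simp add: mult.commute)
  qed (auto simp: srw_op_def intro!: mult_nonneg_nonneg sum_nonneg)
  have "(\<Sum>x\<in>F. (cmod (srw_op V adj k f x))\<^sup>2) \<le> real D * (real D * U)"
    if F: "finite F" "F \<subseteq> V" for F
  proof -
    define G where "G = (\<Union>x\<in>F. N x)"
    have G: "finite G" "G \<subseteq> V" using F N by (auto simp: G_def N_def)
    have "(\<Sum>x\<in>F. \<Sum>y\<in>N x. (cmod (f y))\<^sup>2) = (\<Sum>x\<in>F. \<Sum>y\<in>G. if y \<in> N x then (cmod (f y))\<^sup>2 else 0)"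
    proof (rule sum.cong)
      fix x assume "x \<in> F"
      then have "G \<inter> N x = N x" by (auto simp: G_def)
      then show "(\<Sum>y\<in>N x. (cmod (f y))\<^sup>2) = (\<Sum>y\<in>G. if y \<in> N x then (cmod (f y))\<^sup>2 else 0)"
        using G by (simp add: sum.inter_restrict[symmetric])
    qed simp
    also have "\<dots> = (\<Sum>y\<in>G. \<Sum>x\<in>F. if y \<in> N x then (cmod (f y))\<^sup>2 else 0)"
      by (rule sum.swap)
    also have "\<dots> \<le> (\<Sum>y\<in>G. real D * (cmod (f y))\<^sup>2)"
    proof (rule sum_mono)
      fix y
      have "(\<Sum>x\<in>F. if y \<in> N x then (cmod (f y))\<^sup>2 else 0) = real (card {x\<in>F. y \<in> N x}) * (cmod (f y))\<^sup>2"
        using F by (simp add: sum.inter_filter[symmetric])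
      also have "card {x\<in>F. y \<in> N x} \<le> card {x. adj y x}"
        using fin sym by (intro card_mono) (auto simp: N_def)
      then have "real (card {x\<in>F. y \<in> N x}) * (cmod (f y))\<^sup>2 \<le> real D * (cmod (f y))\<^sup>2"
        using deg[of y] by (intro mult_right_mono) auto
      finally show "(\<Sum>x\<in>F. if y \<in> N x then (cmod (f y))\<^sup>2 else 0) \<le> real D * (cmod (f y))\<^sup>2" .
    qed
    also have "\<dots> = real D * (\<Sum>y\<in>G. (cmod (f y))\<^sup>2)" by (simp add: sum_distrib_left)
    also have "\<dots> \<le> real D * U"
      unfolding U_def using fsum G by (intro mult_left_mono finite_sum_le_infsum) auto
    finally have swap: "(\<Sum>x\<in>F. \<Sum>y\<in>N x. (cmod (f y))\<^sup>2) \<le> real D * U" .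
    have "(\<Sum>x\<in>F. (cmod (srw_op V adj k f x))\<^sup>2) \<le> (\<Sum>x\<in>F. real D * (\<Sum>y\<in>N x. (cmod (f y))\<^sup>2))"
      by (intro sum_mono pointwise)
    also have "\<dots> \<le> real D * (real D * U)"
      unfolding sum_distrib_left[symmetric] using swap by (rule mult_left_mono) simp
    finally show ?thesis .
  qed
  then have "(\<lambda>x. (cmod (srw_op V adj k f x))\<^sup>2) summable_on V"
    by (intro nonneg_bdd_above_summable_on bdd_aboveI2[where M = "real D * (real D * U)"]) auto
  then show ?thesis by (auto simp: ell2_def srw_op_def)
qed

section \<open>Resolutions of the identity and eigenvectors\<close>

text \<open>The first moments of the resolution give the quadratic form of \<open>T\<close> only; the linearity of \<open>T\<close> is
  what recovers the sesquilinear form, by polarization.\<close>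

locale resolution =
  fixes V :: "'v set" and T :: "('v \<Rightarrow> complex) \<Rightarrow> ('v \<Rightarrow> complex)"
    and E :: "real set \<Rightarrow> ('v \<Rightarrow> complex) \<Rightarrow> ('v \<Rightarrow> complex)"
  assumes res: "resolution_of_identity V T E"
    and T_ell2: "f \<in> ell2 V \<Longrightarrow> T f \<in> ell2 V"
    and T_add: "T (\<lambda>x. f x + g x) = (\<lambda>x. T f x + T g x)"
    and T_scale: "T (\<lambda>x. c * f x) = (\<lambda>x. c * T f x)"
begin

abbreviation ip :: "('v \<Rightarrow> complex) \<Rightarrow> ('v \<Rightarrow> complex) \<Rightarrow> complex" where
  "ip \<equiv> ell2_inner V"

lemma pvm: "projection_valued_measure V E"
  using res by (simp add: resolution_of_identity_def)

lemma proj: "A \<in> sets borel \<Longrightarrow> orthogonal_projection V (E A)"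
  using pvm by (simp add: projection_valued_measure_def)

lemma E_ell2: "A \<in> sets borel \<Longrightarrow> f \<in> ell2 V \<Longrightarrow> E A f \<in> ell2 V"
  using proj[of A] by (auto simp: orthogonal_projection_def)

lemma E_add: "A \<in> sets borel \<Longrightarrow> f \<in> ell2 V \<Longrightarrow> g \<in> ell2 V \<Longrightarrow>
    E A (\<lambda>x. f x + g x) = (\<lambda>x. E A f x + E A g x)"
  using proj[of A] by (auto simp: orthogonal_projection_def)

lemma E_scale: "A \<in> sets borel \<Longrightarrow> f \<in> ell2 V \<Longrightarrow> E A (\<lambda>x. c * f x) = (\<lambda>x. c * E A f x)"
  using proj[of A] by (auto simp: orthogonal_projection_def)

lemma E_sum:
  assumes A: "A \<in> sets borel"
  shows "finite I \<Longrightarrow> (\<And>i. i \<in> I \<Longrightarrow> f i \<in> ell2 V) \<Longrightarrow>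
    E A (\<lambda>x. \<Sum>i\<in>I. f i x) = (\<lambda>x. \<Sum>i\<in>I. E A (f i) x)"
proof (induction I rule: finite_induct)
  case empty
  show ?case using E_scale[OF A ell2_0, of 0] by simp
next
  case (insert i I)
  then have "(\<lambda>x. \<Sum>i\<in>I. f i x) \<in> ell2 V" by (intro ell2_sum) auto
  then show ?case using insert by (simp add: E_add[OF A])
qed

lemma E_adjoint: "A \<in> sets borel \<Longrightarrow> f \<in> ell2 V \<Longrightarrow> g \<in> ell2 V \<Longrightarrow> ip (E A f) g = ip f (E A g)"
  using proj[of A] by (auto simp: orthogonal_projection_def)

lemma E_Int: "A \<in> sets borel \<Longrightarrow> B \<in> sets borel \<Longrightarrow> f \<in> ell2 V \<Longrightarrow> E (A \<inter> B) f = E A (E B f)"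
  using pvm by (simp add: projection_valued_measure_def)

lemma E_UNIV: "f \<in> ell2 V \<Longrightarrow> E UNIV f = f"
  using pvm by (simp add: projection_valued_measure_def)

lemma E_sums: "range A \<subseteq> sets borel \<Longrightarrow> disjoint_family A \<Longrightarrow> f \<in> ell2 V \<Longrightarrow> g \<in> ell2 V \<Longrightarrow>
    (\<lambda>i. ip f (E (A i) g)) sums ip f (E (\<Union>i. A i) g)" for A :: "nat \<Rightarrow> real set"
  using pvm by (simp add: projection_valued_measure_def)

lemma ip_E_empty: "f \<in> ell2 V \<Longrightarrow> g \<in> ell2 V \<Longrightarrow> ip f (E {} g) = 0"
  using E_sums[of "\<lambda>_. {}" f g] by (auto simp: disjoint_family_on_def sums_iff summable_const_iff)

lemma E_empty: "f \<in> ell2 V \<Longrightarrow> E {} f = (\<lambda>x. 0)"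
  by (rule ell2_inner_self_eq_0[of _ V]) (auto intro: ip_E_empty E_ell2)

text \<open>Additivity is postulated weakly, for inner products; a difference that is orthogonal to itself
  vanishes.\<close>

lemma E_Un:
  assumes "A \<in> sets borel" "B \<in> sets borel" "A \<inter> B = {}" "f \<in> ell2 V"
  shows "E (A \<union> B) f = (\<lambda>x. E A f x + E B f x)"
proof -
  define d where "d = (\<lambda>x. E (A \<union> B) f x + (- 1) * (E A f x + E B f x))"
  have mem: "E (A \<union> B) f \<in> ell2 V" "E A f \<in> ell2 V" "E B f \<in> ell2 V"
    using assms by (auto intro: E_ell2)
  then have d: "d \<in> ell2 V"
    unfolding d_def by (intro ell2_add ell2_scale)
  have "ip g (E (A \<union> B) f) = ip g (E A f) + ip g (E B f)" if g: "g \<in> ell2 V" for g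
  proof -
    have "range (binaryset A B) \<subseteq> sets borel"
      using assms by (auto simp: range_binaryset_eq)
    moreover have "disjoint_family (binaryset A B)"
      using assms by (auto simp: disjoint_family_on_def binaryset_def)
    ultimately have "(\<lambda>n. ip g (E (binaryset A B n) f)) sums ip g (E (A \<union> B) f)"
      using E_sums[of "binaryset A B" g f] assms g UN_binaryset_eq[of A B] by simp
    moreover have "(\<lambda>n. ip g (E (binaryset A B n) f)) sums (ip g (E A f) + ip g (E B f))"
      using ip_E_empty[OF g assms(4)] by (rule binaryset_sums)
    ultimately show ?thesis by (rule sums_unique2)
  qed
  then have eq: "ip d (E (A \<union> B) f) = ip d (E A f) + ip d (E B f)" using d .
  have "ip d d = ip d (\<lambda>x. E (A \<union> B) f x + (- 1) * (E A f x + E B f x))"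
    by (subst (2) d_def) simp
  also have "\<dots> = ip d (E (A \<union> B) f) + ip d (\<lambda>x. (- 1) * (E A f x + E B f x))"
    using d mem by (intro ell2_inner_add_right ell2_scale ell2_add)
  also have "ip d (\<lambda>x. (- 1) * (E A f x + E B f x)) = (- 1) * (ip d (E A f) + ip d (E B f))"
    by (simp only: ell2_inner_scale_right ell2_inner_add_right[OF d mem(2,3)])
  finally have "ip d d = 0" using eq by simp
  then have "d = (\<lambda>x. 0)" using ell2_inner_self_eq_0 d by blast
  then have "E (A \<union> B) f x + (- 1) * (E A f x + E B f x) = 0" for x
    unfolding d_def by (rule fun_cong)
  then show ?thesis by (auto simp: add_eq_0_iff2 fun_eq_iff)
qed

lemma E_idem: "A \<in> sets borel \<Longrightarrow> f \<in> ell2 V \<Longrightarrow> E A (E A f) = E A f"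
  using E_Int[of A A f] by simp

lemma ip_E_norm:
  assumes "A \<in> sets borel" "f \<in> ell2 V"
  shows "ip f (E A f) = ip (E A f) (E A f)"
  using E_adjoint[of A f "E A f"] assms by (simp add: E_ell2 E_idem)

lemma ip_E_nonneg: "A \<in> sets borel \<Longrightarrow> f \<in> ell2 V \<Longrightarrow> 0 \<le> Re (ip f (E A f))"
  by (simp add: ip_E_norm E_ell2 ell2_inner_self infsum_nonneg)

lemma sets_diag [simp, measurable_cong]: "sets (diagonal_measure V E f) = sets borel"
  and space_diag [simp]: "space (diagonal_measure V E f) = UNIV"
  unfolding diagonal_measure_def
  using sets.sigma_sets_eq[of "borel :: real measure"]
  by (auto simp: sets_measure_of_conv space_measure_of_conv)

lemma emeasure_diag:
  assumes f: "f \<in> ell2 V" and A: "A \<in> sets borel"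
  shows "emeasure (diagonal_measure V E f) A = ennreal (Re (ip f (E A f)))"
proof (rule emeasure_measure_of[OF diagonal_measure_def])
  show "positive (sets (diagonal_measure V E f)) (\<lambda>A. ennreal (Re (ip f (E A f))))"
    using ip_E_empty[OF f f] by (simp add: positive_def)
  show "countably_additive (sets (diagonal_measure V E f)) (\<lambda>A. ennreal (Re (ip f (E A f))))"
  proof (rule countably_additiveI)
    fix B :: "nat \<Rightarrow> real set"
    assume B: "range B \<subseteq> sets (diagonal_measure V E f)" "disjoint_family B"
    then have "(\<lambda>i. Re (ip f (E (B i) f))) sums Re (ip f (E (\<Union>i. B i) f))"
      using E_sums[of B f f] f by (intro sums_Re) auto
    then show "(\<Sum>i. ennreal (Re (ip f (E (B i) f)))) = ennreal (Re (ip f (E (\<Union> (range B)) f)))"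
      using B f by (intro suminf_ennreal_eq) (auto intro!: ip_E_nonneg)
  qed
qed (use A in auto)

text \<open>Applying \<open>E A\<close> to a vector restricts its measure to \<open>A\<close>, by multiplicativity of \<open>E\<close>.\<close>

lemma diag_E:
  assumes A: "A \<in> sets borel" and f: "f \<in> ell2 V"
  shows "diagonal_measure V E (E A f) = density (diagonal_measure V E f) (indicator A)"
proof (rule measure_eqI)
  fix B assume "B \<in> sets (diagonal_measure V E (E A f))"
  then have B: "B \<in> sets borel" by simp
  have "ip (E A f) (E B (E A f)) = ip f (E (A \<inter> B) f)"
    using A B f E_Int[of A "B \<inter> A" f]
    by (simp add: E_adjoint E_ell2 E_Int[symmetric] Int_commute Int_left_commute)
  then show "emeasure (diagonal_measure V E (E A f)) B =
      emeasure (density (diagonal_measure V E f) (indicator A)) B"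
    using A B f
    by (simp add: emeasure_diag E_ell2 emeasure_density flip: indicator_inter_arith)
qed simp

lemma quadratic_form:
  assumes "f \<in> ell2 V"
  shows "integrable (diagonal_measure V E f) (\<lambda>t. t)"
    "ip f (T f) = of_real (\<integral>t. t \<partial>diagonal_measure V E f)"
  using res assms by (auto simp: resolution_of_identity_def)

text \<open>The measure of \<open>f\<close> is the sum of the measures of its components \<open>E A f\<close> and \<open>E (- A) f\<close>, so
  the cross terms cancel in the quadratic form of \<open>T\<close>.\<close>

lemma quadratic_form_split:
  assumes A: "A \<in> sets borel" and f: "f \<in> ell2 V"
  shows "ip f (T f) = ip (E A f) (T (E A f)) + ip (E (- A) f) (T (E (- A) f))"
proof -
  let ?M = "diagonal_measure V E f"
  have A': "- A \<in> sets borel" using A by auto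
  have part: "(\<integral>t. t \<partial>diagonal_measure V E (E B f)) = (\<integral>t. indicator B t * t \<partial>?M)"
      "integrable ?M (\<lambda>t. indicator B t * t)"
    if "B \<in> sets borel" for B
  proof -
    have "density ?M (indicator B) = density ?M (\<lambda>t. ennreal (indicator B t))"
      by (simp add: ennreal_indicator)
    then show "(\<integral>t. t \<partial>diagonal_measure V E (E B f)) = (\<integral>t. indicator B t * t \<partial>?M)"
      using that f by (simp add: diag_E integral_density)
    show "integrable ?M (\<lambda>t. indicator B t * t)"
      using quadratic_form(1)[OF f] integrable_mult_indicator[of B ?M "\<lambda>t. t"] that by simp
  qed
  have "(\<integral>t. t \<partial>?M) = (\<integral>t. indicator A t * t + indicator (- A) t * t \<partial>?M)"
    by (intro Bochner_Integration.integral_cong) (auto simp: indicator_def)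
  also have "\<dots> = (\<integral>t. t \<partial>diagonal_measure V E (E A f)) + (\<integral>t. t \<partial>diagonal_measure V E (E (- A) f))"
    using A A' part by simp
  finally show ?thesis
    using f A A' by (simp add: quadratic_form(2) E_ell2)
qed

text \<open>Polarization: multiplying the second component by \<open>1\<close> and by \<open>\<i>\<close> separates the two cross terms
  whose sum is known to vanish.\<close>

lemma no_cross_terms:
  assumes A: "A \<in> sets borel" and f: "f \<in> ell2 V"
  shows "ip (E A f) (T (E (- A) f)) = 0"
proof -
  define g h where "g = E A f" and "h = E (- A) f"
  have A': "- A \<in> sets borel" using A by auto
  have mem: "g \<in> ell2 V" "h \<in> ell2 V" "T g \<in> ell2 V" "T h \<in> ell2 V"
    using A A' f by (auto simp: g_def h_def intro!: E_ell2 T_ell2)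
  have gh: "E A g = g" "E (- A) h = h" "E A h = (\<lambda>x. 0)" "E (- A) g = (\<lambda>x. 0)"
    using A A' f E_Int[of A "- A" f] E_Int[of "- A" A f] by (simp_all add: g_def h_def E_idem E_empty)
  have cross: "c * ip g (T h) + cnj c * ip h (T g) = 0" for c
  proof -
    let ?f = "\<lambda>x. g x + c * h x"
    have ch: "(\<lambda>x. c * h x) \<in> ell2 V" "(\<lambda>x. c * T h x) \<in> ell2 V"
      using mem by (auto intro: ell2_scale)
    have "E A ?f = g" "E (- A) ?f = (\<lambda>x. c * h x)"
      using mem ch gh A A' by (simp_all add: E_add E_scale)
    then have "ip ?f (T ?f) = ip g (T g) + ip (\<lambda>x. c * h x) (T (\<lambda>x. c * h x))"
      using quadratic_form_split[OF A ell2_add[OF mem(1) ch(1)]] by simp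
    moreover have "ip ?f (T ?f) = ip g (T g) + c * ip g (T h) + cnj c * ip h (T g) +
        ip (\<lambda>x. c * h x) (T (\<lambda>x. c * h x))"
      using mem ch ell2_add[OF mem(3) ch(2)]
      by (simp add: T_add T_scale ell2_inner_add_left ell2_inner_add_right
          ell2_inner_scale_left ell2_inner_scale_right algebra_simps)
    ultimately show ?thesis by simp
  qed
  have "ip g (T h) + ip h (T g) = 0" "\<i> * (ip g (T h) - ip h (T g)) = 0"
    using cross[of 1] cross[of \<i>] by (simp_all add: algebra_simps)
  then have "ip g (T h) + ip h (T g) = 0" "ip g (T h) = ip h (T g)" by auto
  then show ?thesis by (simp add: g_def h_def)
qed

text \<open>For an eigenvector \<open>f\<close> the component \<open>g = E A f\<close> satisfies \<open>\<langle>g, T g\<rangle> = \<mu> \<langle>g, g\<rangle>\<close>. If \<open>A\<close> lies on one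
  side of \<open>\<mu>\<close>, then \<open>t - \<mu>\<close> has constant sign on the support of the measure of \<open>g\<close> while its
  integral vanishes, which forces \<open>g = 0\<close>.\<close>

lemma eigenvector_one_sided:
  fixes \<mu> \<epsilon> :: real
  assumes f: "f \<in> ell2 V" and eig: "T f = (\<lambda>x. of_real \<mu> * f x)"
    and A: "A \<in> sets borel" and sgn: "\<And>t. t \<in> A \<Longrightarrow> 0 < \<epsilon> * (t - \<mu>)"
  shows "E A f = (\<lambda>x. 0)"
proof -
  define g where "g = E A f"
  have A': "- A \<in> sets borel" using A by auto
  have g: "g \<in> ell2 V" using A f by (simp add: g_def E_ell2)
  let ?M = "diagonal_measure V E g"
  have split: "f = (\<lambda>x. g x + E (- A) f x)"
    using E_Un[OF A A' _ f] E_UNIV[OF f] by (simp add: g_def)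
  have "ip g (T f) = ip g (T g) + ip g (T (E (- A) f))"
    using g A' f by (subst split, subst T_add) (simp add: ell2_inner_add_right T_ell2 E_ell2)
  also have "\<dots> = ip g (T g)" using no_cross_terms[OF A f] by (simp add: g_def)
  finally have "ip g (T g) = of_real \<mu> * ip g f" by (simp add: eig ell2_inner_scale_right)
  also have "ip g f = ip g g"
    using A f by (simp add: g_def E_adjoint E_idem E_ell2)
  finally have form: "ip g (T g) = of_real \<mu> * ip g g" .
  have total: "emeasure ?M UNIV = ennreal (Re (ip g g))"
    using g by (simp add: emeasure_diag E_UNIV)
  interpret finite_measure ?M by (rule finite_measureI) (simp add: total)
  have meas: "measure ?M UNIV = Re (ip g g)"
    using ip_E_nonneg[of UNIV g] g by (simp add: measure_def total E_UNIV)
  have gg: "ip g g = of_real (Re (ip g g))" by (simp add: ell2_inner_self[OF g])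
  have "complex_of_real (\<integral>t. t \<partial>?M) = of_real (\<mu> * measure ?M UNIV)"
    using form quadratic_form(2)[OF g] gg meas by (metis of_real_mult)
  then have int: "(\<integral>t. t \<partial>?M) = \<mu> * measure ?M UNIV" unfolding of_real_eq_iff .
  have "emeasure ?M (- A) = 0"
    using g A A' f E_Int[of "- A" A f] ip_E_empty[OF g f] by (simp add: emeasure_diag g_def)
  then have AE: "AE t in ?M. t \<in> A"
    using A' by (intro AE_I[of _ _ "- A"]) auto
  have integrable: "integrable ?M (\<lambda>t. \<epsilon> * (t - \<mu>))"
    using quadratic_form(1)[OF g] by auto
  have "(\<integral>t. \<epsilon> * (t - \<mu>) \<partial>?M) = 0"
    using quadratic_form(1)[OF g] int by simp
  moreover have nonneg: "AE t in ?M. 0 \<le> \<epsilon> * (t - \<mu>)"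
    using AE by eventually_elim (use sgn in force)
  ultimately have "AE t in ?M. \<epsilon> * (t - \<mu>) = 0"
    using integral_nonneg_eq_0_iff_AE[OF integrable nonneg] by simp
  with AE have "AE t in ?M. False" by eventually_elim (use sgn in force)
  then have "emeasure ?M UNIV = 0" by (simp add: AE_iff_measurable[where N = UNIV])
  then have "Re (ip g g) = 0"
    using ip_E_nonneg[of UNIV g] g by (simp add: total E_UNIV)
  then have "ip g g = 0" using gg by simp
  then show ?thesis using ell2_inner_self_eq_0[OF g] by (simp add: g_def)
qed

text \<open>The complement of \<open>\<mu>\<close> consists of two half-lines, on each of which the eigenvector has no mass.\<close>

lemma eigenvector_E:
  fixes \<mu> :: real
  assumes f: "f \<in> ell2 V" and eig: "T f = (\<lambda>x. of_real \<mu> * f x)"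
  shows "E {\<nu>} f = (if \<nu> = \<mu> then f else (\<lambda>x. 0))"
proof -
  have "E {..<\<mu>} f = (\<lambda>x. 0)"
    using f eig by (rule eigenvector_one_sided[where \<epsilon> = "-1"]) auto
  moreover have "E {\<mu><..} f = (\<lambda>x. 0)"
    using f eig by (rule eigenvector_one_sided[where \<epsilon> = 1]) auto
  moreover have "{..<\<mu>} \<inter> {\<mu><..} = {}" "{..<\<mu>} \<union> {\<mu><..} = - {\<mu>}" by auto
  ultimately have "E (- {\<mu>}) f = (\<lambda>x. 0)"
    using E_Un[of "{..<\<mu>}" "{\<mu><..}" f] f by simp
  then have 1: "E {\<mu>} f = f"
    using E_Un[of "{\<mu>}" "- {\<mu>}" f] E_UNIV[OF f] f by simp
  have "E {\<nu>} f = (\<lambda>x. 0)" if "\<nu> \<noteq> \<mu>"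
    using E_Int[of "{\<nu>}" "{\<mu>}" f] that f 1 E_empty[OF f] by simp
  with 1 show ?thesis by auto
qed

end

section \<open>Sines and cosines at rational multiples of pi\<close>

text \<open>The Dirichlet kernel, by telescoping.\<close>

lemma sum_cos_multiples:
  fixes x :: real
  shows "2 * sin (x / 2) * (\<Sum>j<N. cos (real j * x)) = sin (real N * x - x / 2) + sin (x / 2)"
proof (induction N)
  case (Suc N)
  have "2 * sin (x / 2) * cos (real N * x) = sin (real N * x + x / 2) - sin (real N * x - x / 2)"
    by (simp add: sin_add sin_diff)
  moreover have "real (Suc N) * x - x / 2 = real N * x + x / 2"
    by (simp add: algebra_simps)
  ultimately show ?case using Suc by (simp add: distrib_left add.commute)
qed simp

lemma sum_cos_eq_odd:
  assumes "0 < t" "t < 2 * N"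
  shows "(\<Sum>j<N. cos (real j * (real t * pi / real N))) = of_bool (odd t)"
proof -
  define x where "x = real t * pi / real N"
  have "real t * pi < (2 * real N) * pi"
    using assms by (intro mult_strict_right_mono) auto
  then have "0 < x / 2" "x / 2 < pi"
    using assms by (auto simp: x_def field_simps)
  then have pos: "sin (x / 2) \<noteq> 0" using sin_gt_zero by fastforce
  have "real N * x = real t * pi" using assms by (simp add: x_def)
  then have "sin (real N * x - x / 2) = - ((-1) ^ t) * sin (x / 2)"
    by (simp add: sin_diff)
  with sum_cos_multiples[of x N]
  have "sin (x / 2) * (2 * (\<Sum>j<N. cos (real j * x))) = sin (x / 2) * (1 - (-1) ^ t)"
    by (simp add: algebra_simps)
  with pos have "2 * (\<Sum>j<N. cos (real j * x)) = 1 - (-1) ^ t" by simp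
  then show ?thesis unfolding x_def[symmetric] by (cases "even t") auto
qed

text \<open>The product of the sines is half the difference of cosines of multiples \<open>\<bar>i - k\<bar>\<close> and \<open>i + k\<close> of the
  angle. These two numbers have the same parity, so the cosine sums cancel unless \<open>i = k\<close>.\<close>

lemma sine_orthogonality:
  assumes "0 < i" "i < N" "0 < k" "k < N"
  shows "(\<Sum>j\<in>{1..<N}. sin (real i * (real j * pi / real N)) * sin (real k * (real j * pi / real N)))
       = (if i = k then real N / 2 else 0)"
proof -
  define a where "a = (if i \<le> k then k - i else i - k)"
  have parity: "odd a \<longleftrightarrow> odd (i + k)" by (auto simp: a_def)
  have prod: "sin (real i * (real j * pi / real N)) * sin (real k * (real j * pi / real N))
      = (cos (real j * (real a * pi / real N)) - cos (real j * (real (i + k) * pi / real N))) / 2" for j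
  proof -
    have "cos (real i * (real j * pi / real N) - real k * (real j * pi / real N))
        = cos (real j * (real a * pi / real N))"
    proof (cases "i \<le> k")
      case True
      then have "real j * (real a * pi / real N)
          = - (real i * (real j * pi / real N) - real k * (real j * pi / real N))"
        by (simp add: a_def of_nat_diff algebra_simps diff_divide_distrib)
      then show ?thesis by (simp only: cos_minus)
    next
      case False
      then have "real j * (real a * pi / real N)
          = real i * (real j * pi / real N) - real k * (real j * pi / real N)"
        by (simp add: a_def of_nat_diff algebra_simps diff_divide_distrib)
      then show ?thesis by simp
    qed
    moreover have "real i * (real j * pi / real N) + real k * (real j * pi / real N)
        = real j * (real (i + k) * pi / real N)"
      by (simp add: add_divide_distrib algebra_simps)
    ultimately show ?thesis by (simp only: sin_times_sin)
  qed
  have "(\<Sum>j\<in>{1..<N}. sin (real i * (real j * pi / real N)) * sin (real k * (real j * pi / real N)))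
      = (\<Sum>j<N. sin (real i * (real j * pi / real N)) * sin (real k * (real j * pi / real N)))"
    by (rule sum.mono_neutral_left) (auto simp: not_less_eq_eq)
  also have "\<dots> = ((\<Sum>j<N. cos (real j * (real a * pi / real N)))
      - (\<Sum>j<N. cos (real j * (real (i + k) * pi / real N)))) / 2"
    unfolding prod by (simp add: sum_subtractf sum_divide_distrib diff_divide_distrib)
  also have "(\<Sum>j<N. cos (real j * (real (i + k) * pi / real N))) = of_bool (odd (i + k))"
    using assms by (intro sum_cos_eq_odd) auto
  also have "(\<Sum>j<N. cos (real j * (real a * pi / real N)))
      = (if i = k then real N else of_bool (odd (i + k)))"
  proof (cases "i = k")
    case False
    then have "0 < a" "a < 2 * N" using assms by (auto simp: a_def)
    from sum_cos_eq_odd[OF this] show ?thesis using False by (simp add: parity)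
  qed (simp add: a_def)
  finally show ?thesis by auto
qed

lemma lambda_mn_eq_iff:
  assumes "0 < q" "0 < r" "0 < m" "m < n" "0 < j" "j < N"
  shows "lambda_mn q r m n = lambda_mn q r j N \<longleftrightarrow> m * N = j * n"
proof -
  have arg: "0 \<le> real a / real b * pi" "real a / real b * pi \<le> pi" if "a < b" for a b :: nat
    using that by (auto simp: field_simps)
  have "lambda_mn q r m n = lambda_mn q r j N \<longleftrightarrow>
      cos (real m / real n * pi) = cos (real j / real N * pi)"
    using assms(1,2) by (auto simp: lambda_mn_def)
  also have "\<dots> \<longleftrightarrow> real m / real n * pi = real j / real N * pi"
    using cos_inj_pi[OF arg(1)[OF assms(4)] arg(2)[OF assms(4)] arg(1)[OF assms(6)] arg(2)[OF assms(6)]]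
    by auto
  also have "\<dots> \<longleftrightarrow> real m * real N = real j * real n"
    using assms by (auto simp: frac_eq_eq)
  also have "\<dots> \<longleftrightarrow> m * N = j * n" unfolding of_nat_mult[symmetric] of_nat_eq_iff ..
  finally show ?thesis .
qed

lemma sin_multiple_eq_0:
  assumes "n dvd N" "0 < n"
  shows "sin (real N * (real m / real n * pi)) = 0"
proof -
  obtain e where "N = n * e" using assms(1) ..
  then have "real N * (real m / real n * pi) = real (e * m) * pi" using assms by simp
  then show ?thesis by (simp only: sin_npi)
qed

section \<open>Zero-sum functions and averages on a genealogy\<close>

context genealogy
begin

lemma finite_children: "finite {y. par y = x}"
  using card_children[of x] p_ge by (intro card_ge_0_finite) auto

lemma descendants: "finite {y. anc k y = v} \<and> card {y. anc k y = v} = p ^ k"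
proof (induction k)
  case (Suc k)
  have eq: "{y. anc (Suc k) y = v} = (\<Union>z\<in>{z. anc k z = v}. {y. par y = z})"
    by (auto simp: funpow_swap1)
  have "card {y. anc (Suc k) y = v} = (\<Sum>z\<in>{z. anc k z = v}. card {y. par y = z})"
    unfolding eq using Suc finite_children by (intro card_UN_disjoint) auto
  then show ?case using Suc finite_children eq by (simp add: card_children)
qed auto

text \<open>The eigenfunctions are built from the function that, on the descendants of \<open>par v\<close> in generation
  \<open>k\<close>, is the orthogonal projection of the indicator of the branch below \<open>v\<close> to the functions with
  zero sum over the branches. It is zero for \<open>k = 0\<close>, so that \<open>sum_branch_children\<close> also covers the
  vertex \<open>par v\<close> itself.\<close>

definition branch :: "'a \<Rightarrow> nat \<Rightarrow> 'a \<Rightarrow> real" where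
  "branch v k y =
     (if k = 0 then 0 else of_bool (anc (k - 1) y = v) - of_bool (anc k y = par v) / real p)"

lemma branch_0 [simp]: "branch v 0 y = 0"
  by (simp add: branch_def)

lemma branch_Suc: "branch v (Suc k) y = of_bool (anc k y = v) - of_bool (anc (Suc k) y = par v) / real p"
  by (simp add: branch_def)

lemma branch_par: "0 < k \<Longrightarrow> branch v k (par y) = branch v (Suc k) y"
  by (cases k) (auto simp: branch_Suc funpow_swap1)

lemma sum_branch_children: "(\<Sum>z | par z = y. branch v (Suc k) z) = real p * branch v k y"
proof (cases k)
  case 0
  have "(\<Sum>z | par z = y. branch v (Suc 0) z)
      = (\<Sum>z | par z = y. of_bool (z = v)) - (\<Sum>z | par z = y. of_bool (y = par v) / real p)"
    by (simp add: branch_Suc sum_subtractf)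
  also have "(\<Sum>z | par z = y. of_bool (z = v)) = (of_bool (y = par v) :: real)"
    using finite_children[of y] by (auto simp: of_bool_def)
  also have "(\<Sum>z | par z = y. of_bool (y = par v) / real p) = (of_bool (y = par v) :: real)"
    using p_ge by (simp add: card_children)
  finally show ?thesis by (simp add: 0)
next
  case (Suc k')
  have "(\<Sum>z | par z = y. branch v (Suc k) z) = (\<Sum>z | par z = y. branch v k y)"
    by (rule sum.cong) (auto simp: Suc branch_par)
  then show ?thesis by (simp add: card_children)
qed

lemma branch_height: "branch v k y \<noteq> 0 \<Longrightarrow> h y = h v + int k - 1"
proof (cases k)
  case (Suc k')
  assume "branch v k y \<noteq> 0"
  then have "anc k' y = v \<or> anc (Suc k') y = par v" by (auto simp: Suc branch_Suc)
  then show ?thesis using h_anc[of k' y] h_anc[of "Suc k'" y] h_par[of v] Suc by auto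
qed simp

lemma finite_branch_support: "finite {y. branch v k y \<noteq> 0}"
proof (rule finite_subset)
  show "{y. branch v k y \<noteq> 0} \<subseteq> {y. anc (k - 1) y = v} \<union> {y. anc k y = par v}"
    by (auto simp: branch_def split: if_splits)
  show "finite ({y. anc (k - 1) y = v} \<union> {y. anc k y = par v})"
    using descendants by blast
qed

text \<open>The uniform distribution on the \<open>p ^ k\<close> vertices that share their \<open>k\<close>-th ancestor with \<open>x\<close>.\<close>

definition avg :: "'a \<Rightarrow> nat \<Rightarrow> 'a \<Rightarrow> real" where
  "avg x k y = of_bool (anc k y = anc k x) / real p ^ k"

text \<open>Consecutive averages differ by a function that lives on one generation below \<open>anc (Suc k) x\<close> and
  has zero sum over the branches there.\<close>

lemma avg_diff: "avg x k y - avg x (Suc k) y = branch (anc k x) (Suc k) y / real p ^ k"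
  by (simp add: avg_def branch_Suc diff_divide_distrib)

text \<open>The first ancestor of \<open>x\<close> that is also one of \<open>y\<close> is \<open>anc d x\<close>. Below it \<open>y\<close> lies in another branch
  than \<open>x\<close>, below any higher ancestor in the same branch; this is the origin of the case
  distinction in the coefficients of the formula.\<close>

lemma branch_at_confluent:
  assumes conf: "\<And>k l. anc k y = anc l x \<longleftrightarrow> (\<exists>t. k = u + t \<and> l = d + t)"
  shows "branch (anc i x) k y =
    (if 0 < k \<and> d \<le> Suc i \<and> k = u + (Suc i - d) then of_bool (d \<le> i) - 1 / real p else 0)"
proof (cases k)
  case (Suc k')
  have "anc k' y = anc i x \<longleftrightarrow> d \<le> i \<and> k' = u + (i - d)"
    unfolding conf by (auto intro!: exI[of _ "i - d"])
  moreover have "anc (Suc k') y = anc (Suc i) x \<longleftrightarrow> d \<le> Suc i \<and> Suc k' = u + (Suc i - d)"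
    unfolding conf by (auto intro!: exI[of _ "Suc i - d"])
  moreover have "par (anc i x) = anc (Suc i) x" by simp
  ultimately show ?thesis unfolding Suc branch_Suc
    by (auto simp del: funpow.simps simp: Suc_diff_le le_Suc_eq)
qed simp

end

section \<open>Eigenfunctions of the walk\<close>

text \<open>The constant \<open>c\<close> replaces the normalization of the heights by roots: the Diestel-Leader graph
  depends on the roots only through the sum of their heights.\<close>

locale horocyclic_product = A: genealogy q par1 h1 + B: genealogy r par2 h2
  for q :: nat and par1 :: "'a \<Rightarrow> 'a" and h1 :: "'a \<Rightarrow> int"
    and r :: nat and par2 :: "'b \<Rightarrow> 'b" and h2 :: "'b \<Rightarrow> int" +
  fixes c :: int
begin

definition V :: "('a \<times> 'b) set" where
  "V = {y. h1 (fst y) + h2 (snd y) = c}"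

definition walk :: "('a \<times> 'b \<Rightarrow> complex) \<Rightarrow> 'a \<times> 'b \<Rightarrow> complex" where
  "walk f y = (if y \<in> V then ((\<Sum>z | par2 z = snd y. f (par1 (fst y), z)) +
      (\<Sum>z | par1 z = fst y. f (z, par2 (snd y)))) / of_nat (q + r) else 0)"

lemma srw_op_eq_walk:
  assumes T1: "\<And>x y. T1 x y \<longleftrightarrow> par1 x = y \<or> par1 y = x"
    and T2: "\<And>x y. T2 x y \<longleftrightarrow> par2 x = y \<or> par2 y = x"
  shows "srw_op V (DL_adj T1 T2) (q + r) = walk"
proof (intro ext)
  fix f :: "'a \<times> 'b \<Rightarrow> complex" and y
  show "srw_op V (DL_adj T1 T2) (q + r) f y = walk f y"
  proof (cases "y \<in> V")
    case True
    obtain y1 y2 where y: "y = (y1, y2)" by (cases y)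
    let ?N1 = "Pair (par1 y1) ` {z. par2 z = y2}" and ?N2 = "(\<lambda>z. (z, par2 y2)) ` {z. par1 z = y1}"
    have "{z. z \<in> V \<and> DL_adj T1 T2 y z} = ?N1 \<union> ?N2"
    proof (intro equalityI subsetI)
      fix z assume "z \<in> {z. z \<in> V \<and> DL_adj T1 T2 y z}"
      then show "z \<in> ?N1 \<union> ?N2"
        using True y A.h_par B.h_par T1 T2 by (cases z) (fastforce simp: V_def DL_adj_def image_iff)
    next
      fix z assume "z \<in> ?N1 \<union> ?N2"
      then show "z \<in> {z. z \<in> V \<and> DL_adj T1 T2 y z}"
        using True y A.h_par B.h_par by (auto simp: V_def DL_adj_def T1 T2)
    qed
    moreover have "?N1 \<inter> ?N2 = {}"
    proof -
      have "par1 (par1 y1) \<noteq> y1" using A.h_par[of y1] A.h_par[of "par1 y1"] by auto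
      then show ?thesis by auto
    qed
    moreover have "sum f ?N1 = (\<Sum>z | par2 z = y2. f (par1 y1, z))"
      by (subst sum.reindex) (auto simp: inj_on_def)
    moreover have "sum f ?N2 = (\<Sum>z | par1 z = y1. f (z, par2 y2))"
      by (subst sum.reindex) (auto simp: inj_on_def)
    ultimately show ?thesis
      using True y A.finite_children B.finite_children
      by (simp add: srw_op_def walk_def sum.union_disjoint)
  qed (simp add: srw_op_def walk_def)
qed

lemma walk_add: "walk (\<lambda>x. f x + g x) = (\<lambda>x. walk f x + walk g x)"
  by (auto simp: walk_def sum.distrib add_divide_distrib fun_eq_iff)

lemma walk_scale: "walk (\<lambda>x. a * f x) = (\<lambda>x. a * walk f x)"
  by (auto simp: walk_def fun_eq_iff distrib_left simp flip: sum_distrib_left)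

text \<open>The product of two branch functions, multiplied by a profile \<open>g\<close> along the levels. Its support
  lies in the finite set of pairs \<open>(y1, y2)\<close> with \<open>y1\<close> below \<open>par1 v\<close>, \<open>y2\<close> below \<open>par2 w\<close> and distances
  \<open>k\<close> and \<open>N - k\<close> to these two vertices (a tetrahedron of height \<open>N\<close>).\<close>

definition block :: "'a \<Rightarrow> 'b \<Rightarrow> nat \<Rightarrow> (nat \<Rightarrow> real) \<Rightarrow> 'a \<times> 'b \<Rightarrow> complex" where
  "block v w N g y =
     of_real (\<Sum>k\<le>N. g k * (A.branch v k (fst y) * B.branch w (N - k) (snd y)))"

lemma block_support:
  assumes vw: "h1 v + h2 w + int N = c + 2" and "block v w N g y \<noteq> 0"
  obtains k where "k \<le> N" "A.branch v k (fst y) \<noteq> 0" "B.branch w (N - k) (snd y) \<noteq> 0" "y \<in> V"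
proof -
  obtain k where k: "k \<le> N" "A.branch v k (fst y) \<noteq> 0" "B.branch w (N - k) (snd y) \<noteq> 0"
    using assms(2) unfolding block_def by (auto elim!: sum.not_neutral_contains_not_neutral)
  then have "y \<in> V"
    using vw A.branch_height[OF k(2)] B.branch_height[OF k(3)] by (simp add: V_def of_nat_diff)
  with k show ?thesis using that by blast
qed

lemma block_ell2:
  assumes vw: "h1 v + h2 w + int N = c + 2"
  shows "block v w N g \<in> ell2 V"
proof (rule ell2_finite_support)
  let ?S = "(\<Union>k\<le>N. {y. A.branch v k y \<noteq> 0}) \<times> (\<Union>k\<le>N. {y. B.branch w k y \<noteq> 0})"
  show "finite (V \<inter> ?S)"
    using A.finite_branch_support B.finite_branch_support by blast
  fix y assume "y \<notin> V \<inter> ?S"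
  then show "block v w N g y = 0"
    using block_support[OF vw, of g y]
    by (cases y) (metis (mono_tags, lifting) IntI SigmaI UN_I atMost_iff
        diff_le_self fst_conv mem_Collect_eq snd_conv)
qed auto

lemma block_sum:
  "finite I \<Longrightarrow> block v w N (\<lambda>k. \<Sum>i\<in>I. a i * g i k) y = (\<Sum>i\<in>I. of_real (a i) * block v w N (g i) y)"
  unfolding block_def of_real_mult[symmetric] of_real_sum[symmetric] of_real_eq_iff
  by (simp add: sum_distrib_right sum_distrib_left mult.assoc sum.swap[of _ I])

text \<open>The zero sums of \<open>branch\<close> over the siblings of \<open>v\<close> and of \<open>w\<close> make the walk on a block a
  weighted nearest neighbour walk on the levels \<open>0 < k < N\<close>, killed at the ends.\<close>

lemma walk_block:
  assumes vw: "h1 v + h2 w + int N = c + 2"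
    and ends0: "g 0 = 0" "g N = 0"
    and rec: "\<And>k. 0 < k \<Longrightarrow> k < N \<Longrightarrow>
      real r * g (k - 1) + real q * g (Suc k) = real (q + r) * \<mu> * g k"
  shows "walk (block v w N g) = (\<lambda>y. of_real \<mu> * block v w N g y)"
proof
  fix y
  show "walk (block v w N g) y = of_real \<mu> * block v w N g y"
  proof (cases "y \<in> V")
    case False
    then show ?thesis using block_support[OF vw, of g y] by (auto simp: walk_def)
  next
    case True
    obtain y1 y2 where y: "y = (y1, y2)" by (cases y)
    let ?A = "\<lambda>k. A.branch v k y1" and ?B = "\<lambda>k. B.branch w k y2"
    have "(\<Sum>z | par2 z = y2. block v w N g (par1 y1, z))
        = of_real (\<Sum>k\<le>N. g k * A.branch v k (par1 y1) * (\<Sum>z | par2 z = y2. B.branch w (N - k) z))"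
      unfolding block_def by (simp add: sum_distrib_left mult.assoc sum.swap[of _ _ "{..N}"])
    \<comment> \<open>The ends drop out, \<open>k = N\<close> because the branch function of index \<open>0\<close> is zero and \<open>k = 0\<close> because
      \<open>g\<close> vanishes there; this is where the zero boundary values are needed.\<close>
    also have "(\<Sum>k\<le>N. g k * A.branch v k (par1 y1) * (\<Sum>z | par2 z = y2. B.branch w (N - k) z))
        = (\<Sum>k<N. g k * A.branch v k (par1 y1) * (\<Sum>z | par2 z = y2. B.branch w (N - k) z))"
      using ends0 by (simp add: lessThan_Suc_atMost[symmetric])
    also have "\<dots> = (\<Sum>k<N. real r * g k * ?A (Suc k) * ?B (N - Suc k))"
    proof (rule sum.cong)
      show "g k * A.branch v k (par1 y1) * (\<Sum>z | par2 z = y2. B.branch w (N - k) z)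
          = real r * g k * ?A (Suc k) * ?B (N - Suc k)" if "k \<in> {..<N}" for k
      proof -
        have "N - k = Suc (N - Suc k)" using that by auto
        then show ?thesis
          using A.branch_par[of k v y1] ends0 B.sum_branch_children[of w "N - Suc k" y2]
          by (cases "k = 0") auto
      qed
    qed simp
    also have "\<dots> = (\<Sum>k\<le>N. real r * g (k - 1) * ?A k * ?B (N - k))"
      by (simp add: sum.atMost_shift)
    finally have 1: "(\<Sum>z | par2 z = y2. block v w N g (par1 y1, z))
        = of_real (\<Sum>k\<le>N. real r * g (k - 1) * ?A k * ?B (N - k))" .
    have "(\<Sum>z | par1 z = y1. block v w N g (z, par2 y2))
        = of_real (\<Sum>k\<le>N. g k * (\<Sum>z | par1 z = y1. A.branch v k z) * B.branch w (N - k) (par2 y2))"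
      unfolding block_def
      by (simp add: sum_distrib_left sum_distrib_right mult.assoc sum.swap[of _ _ "{..N}"])
    also have "(\<Sum>k\<le>N. g k * (\<Sum>z | par1 z = y1. A.branch v k z) * B.branch w (N - k) (par2 y2))
        = (\<Sum>k<N. g (Suc k) * (\<Sum>z | par1 z = y1. A.branch v (Suc k) z)
             * B.branch w (N - Suc k) (par2 y2))"
      by (simp add: sum.atMost_shift)
    also have "\<dots> = (\<Sum>k<N. real q * g (Suc k) * ?A k * ?B (N - k))"
    proof (rule sum.cong)
      fix k assume "k \<in> {..<N}"
      then show "g (Suc k) * (\<Sum>z | par1 z = y1. A.branch v (Suc k) z) * B.branch w (N - Suc k) (par2 y2)
          = real q * g (Suc k) * ?A k * ?B (N - k)"
        using B.branch_par[of "N - Suc k" w y2] ends0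
        by (cases "Suc k = N") (auto simp: A.sum_branch_children Suc_diff_Suc)
    qed simp
    also have "\<dots> = (\<Sum>k\<le>N. real q * g (Suc k) * ?A k * ?B (N - k))"
      by (simp add: lessThan_Suc_atMost[symmetric])
    finally have 2: "(\<Sum>z | par1 z = y1. block v w N g (z, par2 y2))
        = of_real (\<Sum>k\<le>N. real q * g (Suc k) * ?A k * ?B (N - k))" .
    have "(\<Sum>k\<le>N. real r * g (k - 1) * ?A k * ?B (N - k)) + (\<Sum>k\<le>N. real q * g (Suc k) * ?A k * ?B (N - k))
        = (\<Sum>k\<le>N. real (q + r) * \<mu> * g k * (?A k * ?B (N - k)))"
      unfolding sum.distrib[symmetric]
    proof (rule sum.cong)
      fix k assume "k \<in> {..N}"
      then consider "k = 0" | "k = N" | "0 < k" "k < N" by fastforce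
      then show "real r * g (k - 1) * ?A k * ?B (N - k) + real q * g (Suc k) * ?A k * ?B (N - k)
          = real (q + r) * \<mu> * g k * (?A k * ?B (N - k))"
      proof cases
        case 3
        show ?thesis unfolding rec[OF 3, symmetric] by (simp add: algebra_simps)
      qed auto
    qed simp
    also have "\<dots> = real (q + r) * (\<mu> * (\<Sum>k\<le>N. g k * (?A k * ?B (N - k))))"
      by (simp add: sum_distrib_left mult.assoc)
    finally have "walk (block v w N g) y
        = of_real (real (q + r) * (\<mu> * (\<Sum>k\<le>N. g k * (?A k * ?B (N - k))))) / of_nat (q + r)"
      using True 1 2 by (simp only: walk_def y fst_conv snd_conv if_True of_real_add[symmetric])
    also have "\<dots> = of_real \<mu> * block v w N g y"
      using A.p_ge by (simp add: block_def y del: of_nat_add)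
    finally show ?thesis .
  qed
qed

end

context horocyclic_product
begin

text \<open>On the profile of a block, the walk weights the level \<open>k - 1\<close> by \<open>r\<close> and the level \<open>k + 1\<close> by \<open>q\<close>.
  Splitting off \<open>ratio ^ k\<close> makes both weights equal to \<open>sqrt (q * r)\<close>, so that what is left is the
  discrete wave equation.\<close>

definition ratio :: real where "ratio = sqrt (real r / real q)"

lemma ratio_pos: "0 < ratio"
  using A.p_ge B.p_ge by (simp add: ratio_def)

lemma ratio_sq: "ratio * ratio = real r / real q"
  unfolding ratio_def by simp

definition wave :: "real \<Rightarrow> nat \<Rightarrow> real" where
  "wave \<theta> k = ratio ^ k * sin (real k * \<theta>)"

lemma wave_recurrence:
  assumes "0 < k"
  shows "real r * wave \<theta> (k - 1) + real q * wave \<theta> (Suc k) = 2 * sqrt (real q * real r) * cos \<theta> * wave \<theta> k"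
proof -
  obtain l where l: "k = Suc l" using assms by (cases k) auto
  have s: "real q * ratio = sqrt (real q * real r)"
  proof -
    have "real q * ratio = (real q / sqrt (real q)) * sqrt (real r)"
      by (simp add: ratio_def real_sqrt_divide)
    also have "real q / sqrt (real q) = sqrt (real q)" by (rule real_div_sqrt) simp
    finally show ?thesis by (simp add: real_sqrt_mult)
  qed
  have "real r = real q * ratio * ratio"
    using A.p_ge by (simp add: mult.assoc ratio_sq)
  then have r: "real r = sqrt (real q * real r) * ratio" by (simp add: s)
  have "sin (real l * \<theta>) + sin (real (Suc k) * \<theta>) = 2 * cos \<theta> * sin (real k * \<theta>)"
  proof -
    have "real l * \<theta> = real k * \<theta> - \<theta>" "real (Suc k) * \<theta> = real k * \<theta> + \<theta>"
      by (simp_all add: l algebra_simps)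
    then show ?thesis by (simp add: sin_add sin_diff)
  qed
  moreover have "real r * wave \<theta> (k - 1) = sqrt (real q * real r) * ratio ^ k * sin (real l * \<theta>)"
    by (subst r) (simp add: wave_def l)
  moreover have "real q * wave \<theta> (Suc k) = sqrt (real q * real r) * ratio ^ k * sin (real (Suc k) * \<theta>)"
    by (simp only: s[symmetric] wave_def power_Suc mult_ac)
  ultimately have "real r * wave \<theta> (k - 1) + real q * wave \<theta> (Suc k)
      = sqrt (real q * real r) * ratio ^ k * (2 * cos \<theta> * sin (real k * \<theta>))"
    by (simp only: distrib_left[symmetric])
  then show ?thesis by (simp add: wave_def)
qed

lemma walk_block_wave:
  assumes vw: "h1 v + h2 w + int N = c + 2" and "0 < N"
  shows "walk (block v w N (wave (real j * pi / real N)))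
    = (\<lambda>y. of_real (lambda_mn q r j N) * block v w N (wave (real j * pi / real N)) y)"
proof (rule walk_block[OF vw])
  let ?\<theta> = "real j * pi / real N"
  show "wave ?\<theta> 0 = 0" by (simp add: wave_def)
  show "wave ?\<theta> N = 0" using assms(2) by (simp add: wave_def)
  have "real (q + r) * lambda_mn q r j N = 2 * sqrt (real q * real r) * cos ?\<theta>"
    using A.p_ge by (simp add: lambda_mn_def del: of_nat_add) (simp add: add_pos_pos)
  then show "real r * wave ?\<theta> (k - 1) + real q * wave ?\<theta> (Suc k)
      = real (q + r) * lambda_mn q r j N * wave ?\<theta> k" if "0 < k" for k
    using wave_recurrence[OF that] by simp
qed

lemma block_cong: "(\<And>k. k \<le> N \<Longrightarrow> g k = g' k) \<Longrightarrow> block v w N g = block v w N g'"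
  by (auto simp: block_def fun_eq_iff intro!: sum.cong)

end

section \<open>Expansion of point masses\<close>

context horocyclic_product
begin

text \<open>The components of \<open>\<delta>\<^sub>x\<close> in the blocks around \<open>x\<close>. The indices count from \<open>0\<close>: the apexes are the
  ancestors of \<open>x\<close> in generations \<open>Suc i\<close> and \<open>Suc j\<close>, and the profile is concentrated at the level
  \<open>Suc i\<close> of \<open>x\<close>.\<close>

definition piece :: "'a \<times> 'b \<Rightarrow> nat \<Rightarrow> nat \<Rightarrow> 'a \<times> 'b \<Rightarrow> complex" where
  "piece x i j = block (A.anc i (fst x)) (B.anc j (snd x)) (i + j + 2)
     (\<lambda>k. of_bool (k = Suc i) / (real q ^ i * real r ^ j))"

definition avg2 :: "'a \<times> 'b \<Rightarrow> nat \<Rightarrow> nat \<Rightarrow> 'a \<times> 'b \<Rightarrow> complex" where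
  "avg2 x i j y = of_real (A.avg (fst x) i (fst y) * B.avg (snd x) j (snd y))"

lemma top_heights:
  "x \<in> V \<Longrightarrow> h1 (A.anc i (fst x)) + h2 (B.anc j (snd x)) + int (i + j + 2) = c + 2"
  by (simp add: A.h_anc B.h_anc V_def)

lemma piece_eq:
  "piece x i j y = of_real ((A.avg (fst x) i (fst y) - A.avg (fst x) (Suc i) (fst y)) *
     (B.avg (snd x) j (snd y) - B.avg (snd x) (Suc j) (snd y)))"
proof -
  let ?t = "\<lambda>k. A.branch (A.anc i (fst x)) k (fst y) * B.branch (B.anc j (snd x)) (i + j + 2 - k) (snd y)"
  have "(\<Sum>k\<le>i + j + 2. of_bool (k = Suc i) / (real q ^ i * real r ^ j) * ?t k)
      = (\<Sum>k\<le>i + j + 2. if k = Suc i then ?t k / (real q ^ i * real r ^ j) else 0)"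
    by (rule sum.cong) auto
  also have "\<dots> = ?t (Suc i) / (real q ^ i * real r ^ j)" by (simp add: sum.delta')
  also have "i + j + 2 - Suc i = Suc j" by simp
  finally show ?thesis
    unfolding piece_def block_def A.avg_diff B.avg_diff by (simp add: field_simps)
qed

text \<open>The identity is the telescoping sum of the differences of averages over descendants, in each
  of the two trees; what remains after finitely many steps is spread over large sets.\<close>

lemma delta_decomposition:
  "delta x y = (\<Sum>i<K. \<Sum>j<K. piece x i j y) + (avg2 x K 0 y + avg2 x 0 K y - avg2 x K K y)"
proof -
  let ?a = "\<lambda>i. A.avg (fst x) i (fst y)" and ?b = "\<lambda>j. B.avg (snd x) j (snd y)"
  have "(\<Sum>i<K. \<Sum>j<K. piece x i j y) = of_real ((\<Sum>i<K. ?a i - ?a (Suc i)) * (\<Sum>j<K. ?b j - ?b (Suc j)))"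
    by (simp only: piece_eq sum_product of_real_sum)
  also have "\<dots> = of_real ((?a 0 - ?a K) * (?b 0 - ?b K))"
    unfolding sum_lessThan_telescope'[of ?a] sum_lessThan_telescope'[of ?b] ..
  finally have "(\<Sum>i<K. \<Sum>j<K. piece x i j y) + (avg2 x K 0 y + avg2 x 0 K y - avg2 x K K y) = avg2 x 0 0 y"
    by (simp add: avg2_def algebra_simps)
  also have "\<dots> = delta x y"
    by (cases x; cases y) (auto simp: avg2_def A.avg_def B.avg_def delta_def)
  finally show ?thesis ..
qed

lemma avg2_uniform:
  assumes "x \<in> V"
  obtains S where "finite S" "S \<subseteq> V" "card S = q ^ i * r ^ j"
    "avg2 x i j = (\<lambda>y. of_bool (y \<in> S) / of_nat (card S))"
proof -
  let ?S = "{y. A.anc i y = A.anc i (fst x)} \<times> {y. B.anc j y = B.anc j (snd x)}"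
  have card: "card ?S = q ^ i * r ^ j"
    using A.descendants B.descendants by (simp add: card_cartesian_product)
  show ?thesis
  proof (rule that[of ?S])
    show "finite ?S" using A.descendants B.descendants by blast
    show "?S \<subseteq> V"
      using assms by (auto simp: V_def dest!: A.anc_eq_height B.anc_eq_height)
    show "avg2 x i j = (\<lambda>y. of_bool (y \<in> ?S) / of_nat (card ?S))"
      unfolding card by (auto simp: avg2_def A.avg_def B.avg_def fun_eq_iff)
  qed (rule card)
qed

lemma avg2_ell2:
  assumes "x \<in> V"
  shows "avg2 x i j \<in> ell2 V"
proof -
  obtain S where S: "finite S" "S \<subseteq> V" "card S = q ^ i * r ^ j"
    "avg2 x i j = (\<lambda>y. of_bool (y \<in> S) / of_nat (card S))"
    by (rule avg2_uniform[OF assms]) (rule that)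
  from S(1,2) show ?thesis by (rule ell2_finite_support) (simp add: S(4))
qed

text \<open>A uniform distribution on at least \<open>2 ^ K\<close> points has squared norm at most \<open>2\<close> to the power
  \<open>- K\<close>.\<close>

lemma avg2_limit:
  assumes x: "x \<in> V" and u: "u \<in> ell2 V" and large: "\<And>K. K \<le> i K + j K"
  shows "(\<lambda>K. ell2_inner V u (avg2 x (i K) (j K))) \<longlonglongrightarrow> 0"
proof (rule Lim_null_comparison)
  let ?U = "\<Sum>\<^sub>\<infinity>y\<in>V. (cmod (u y))\<^sup>2"
  have U: "0 \<le> ?U" by (rule infsum_nonneg) auto
  show "\<forall>\<^sub>F K in sequentially. norm (ell2_inner V u (avg2 x (i K) (j K))) \<le> sqrt (?U * (1 / 2) ^ K)"
  proof (rule always_eventually, rule allI)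
    fix K
    obtain S where S: "finite S" "S \<subseteq> V" "card S = q ^ i K * r ^ j K"
      "avg2 x (i K) (j K) = (\<lambda>y. of_bool (y \<in> S) / of_nat (card S))"
      by (rule avg2_uniform[OF x]) (rule that)
    have "(2::nat) ^ K \<le> 2 ^ (i K + j K)" using large[of K] by (intro power_increasing) auto
    also have "\<dots> \<le> card S"
      unfolding S(3) power_add using A.p_ge B.p_ge by (intro mult_mono power_mono) auto
    finally have "2 ^ K \<le> real (card S)" by (metis of_nat_le_iff of_nat_numeral of_nat_power)
    moreover from this have "0 < real (card S)" by (rule less_le_trans[rotated]) simp
    ultimately have "?U / real (card S) \<le> ?U / 2 ^ K" using U by (intro divide_left_mono) auto
    then have "(cmod (ell2_inner V u (avg2 x (i K) (j K))))\<^sup>2 \<le> ?U * (1 / 2) ^ K"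
      using ell2_inner_uniform_bound[OF u S(1,2)] S(4) by (simp add: power_divide)
    then show "norm (ell2_inner V u (avg2 x (i K) (j K))) \<le> sqrt (?U * (1 / 2) ^ K)"
      by (rule real_le_rsqrt)
  qed
  have "(\<lambda>K. sqrt (?U * (1 / 2) ^ K)) \<longlonglongrightarrow> sqrt (?U * 0)"
    by (intro tendsto_intros LIMSEQ_power_zero) auto
  then show "(\<lambda>K. sqrt (?U * (1 / 2) ^ K)) \<longlonglongrightarrow> 0" by simp
qed

text \<open>The spectral projection is self-adjoint, so the remainder of the decomposition is paired with
  the fixed vector \<open>E S (delta z)\<close>.\<close>

lemma E_delta_limit:
  assumes "resolution V walk E" and S: "S \<in> sets borel" and x: "x \<in> V" and z: "z \<in> V"
  shows "(\<lambda>K. \<Sum>i<K. \<Sum>j<K. E S (piece x i j) z) \<longlonglongrightarrow> spectral_measure V E z x S"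
proof -
  interpret R: resolution V walk E by fact
  define u where "u = E S (delta z)"
  have u: "u \<in> ell2 V" using S z by (simp add: u_def R.E_ell2 delta_ell2)
  have ip: "E S f z = ell2_inner V u f" if "f \<in> ell2 V" for f
    using R.E_adjoint[OF S delta_ell2[OF z] that] ell2_inner_delta[OF z] by (simp add: u_def)
  have pc: "piece x i j \<in> ell2 V" for i j
    unfolding piece_def by (rule block_ell2[OF top_heights[OF x]])
  have "spectral_measure V E z x S = (\<Sum>i<K. \<Sum>j<K. E S (piece x i j) z) +
      (ell2_inner V u (avg2 x K 0) + ell2_inner V u (avg2 x 0 K) + (- 1) * ell2_inner V u (avg2 x K K))" for K
  proof -
    let ?rest = "\<lambda>y. (avg2 x K 0 y + avg2 x 0 K y) + (- 1) * avg2 x K K y"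
    have rest: "?rest \<in> ell2 V" by (intro ell2_add ell2_scale avg2_ell2 x)
    have row: "(\<lambda>y. \<Sum>j<K. piece x i j y) \<in> ell2 V" for i by (rule ell2_sum) (auto intro: pc)
    then have sq: "(\<lambda>y. \<Sum>i<K. \<Sum>j<K. piece x i j y) \<in> ell2 V"
      by (intro ell2_sum[where f = "\<lambda>i y. \<Sum>j<K. piece x i j y"]) simp_all
    have "delta x = (\<lambda>y. (\<Sum>i<K. \<Sum>j<K. piece x i j y) + ?rest y)"
      using delta_decomposition[of x _ K] by (simp add: fun_eq_iff)
    then have "E S (delta x) = (\<lambda>y. (\<Sum>i<K. \<Sum>j<K. E S (piece x i j) y) + E S ?rest y)"
      using R.E_add[OF S sq rest] R.E_sum[OF S, of "{..<K}" "\<lambda>i y. \<Sum>j<K. piece x i j y"]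
        R.E_sum[OF S, of "{..<K}" "\<lambda>j. piece x i j" for i] row pc by simp
    moreover have "E S ?rest z = ell2_inner V u (avg2 x K 0) + ell2_inner V u (avg2 x 0 K)
        + (- 1) * ell2_inner V u (avg2 x K K)"
      unfolding ip[OF rest]
      by (simp only: ell2_inner_add_right[OF u] ell2_inner_scale_right ell2_add ell2_scale avg2_ell2[OF x])
    moreover have "spectral_measure V E z x S = E S (delta x) z"
      by (simp add: spectral_measure_def ell2_inner_delta[OF z])
    ultimately show ?thesis by simp
  qed
  then have "(\<lambda>K. \<Sum>i<K. \<Sum>j<K. E S (piece x i j) z) = (\<lambda>K. spectral_measure V E z x S -
      (ell2_inner V u (avg2 x K 0) + ell2_inner V u (avg2 x 0 K) + (- 1) * ell2_inner V u (avg2 x K K)))"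
    by (simp add: fun_eq_iff eq_diff_eq)
  moreover have "\<dots> \<longlonglongrightarrow> spectral_measure V E z x S - (0 + 0 + (- 1) * 0)"
    by (intro tendsto_intros avg2_limit x u) auto
  ultimately show ?thesis by simp
qed

text \<open>The sine orthogonality expands the point profile of a piece in the waves of its block, whose
  eigenvalues are \<open>lambda_mn q r l N\<close> with \<open>0 < l < N\<close>. The projection keeps the wave with
  \<open>l / N = m / n\<close>; since \<open>m\<close> and \<open>n\<close> are coprime there is one exactly if \<open>n\<close> divides \<open>N\<close>.\<close>

lemma E_piece:
  assumes "resolution V walk E" and x: "x \<in> V" and mn: "0 < m" "m < n" "coprime m n"
  shows "E {lambda_mn q r m n} (piece x i j) = (\<lambda>y. if n dvd i + j + 2 then
      of_real (2 / real (i + j + 2) * sin (real (Suc i) * (real m / real n * pi)) /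
        (ratio ^ Suc i * real q ^ i * real r ^ j)) *
      block (A.anc i (fst x)) (B.anc j (snd x)) (i + j + 2) (wave (real m / real n * pi)) y else 0)"
proof -
  interpret R: resolution V walk E by fact
  define N where "N = i + j + 2"
  define v where "v = A.anc i (fst x)"
  define w where "w = B.anc j (snd x)"
  have N: "0 < N" "Suc i < N" by (auto simp: N_def)
  have vw: "h1 v + h2 w + int N = c + 2"
    unfolding v_def w_def N_def by (rule top_heights[OF x])
  define b where "b = (\<lambda>l. 2 / real N * sin (real (Suc i) * (real l * pi / real N)) /
    (ratio ^ Suc i * real q ^ i * real r ^ j))"
  let ?w = "\<lambda>l. wave (real l * pi / real N)"
  \<comment> \<open>The coefficients \<open>b l\<close> expand the point profile at level \<open>Suc i\<close>; \<open>N / 2\<close> is the squared norm of a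
    sine wave.\<close>
  have expand: "of_bool (k = Suc i) / (real q ^ i * real r ^ j) = (\<Sum>l\<in>{1..<N}. b l * ?w l k)"
    if "k \<le> N" for k
  proof -
    have "(\<Sum>l\<in>{1..<N}. b l * ?w l k)
        = 2 / real N * ratio ^ k / (ratio ^ Suc i * real q ^ i * real r ^ j) *
          (\<Sum>l\<in>{1..<N}. sin (real (Suc i) * (real l * pi / real N)) * sin (real k * (real l * pi / real N)))"
      unfolding sum_distrib_left by (rule sum.cong) (auto simp: b_def wave_def field_simps)
    also have "(\<Sum>l\<in>{1..<N}. sin (real (Suc i) * (real l * pi / real N)) * sin (real k * (real l * pi / real N)))
        = (if Suc i = k then real N / 2 else 0)"
    proof (cases "k = 0 \<or> k = N")
      case True
      then have "sin (real k * (real l * pi / real N)) = 0" for l using N by auto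
      then show ?thesis using True N by auto
    next
      case False
      then show ?thesis using that N by (intro sine_orthogonality) auto
    qed
    finally show ?thesis using ratio_pos N by (auto simp: field_simps)
  qed
  have "piece x i j = block v w N (\<lambda>k. \<Sum>l\<in>{1..<N}. b l * ?w l k)"
    unfolding piece_def v_def[symmetric] w_def[symmetric] N_def[symmetric]
    by (intro block_cong expand)
  also have "\<dots> = (\<lambda>y. \<Sum>l\<in>{1..<N}. of_real (b l) * block v w N (?w l) y)"
    by (simp add: block_sum fun_eq_iff)
  finally have "E {lambda_mn q r m n} (piece x i j)
      = (\<lambda>y. \<Sum>l\<in>{1..<N}. E {lambda_mn q r m n} (\<lambda>y. of_real (b l) * block v w N (?w l) y) y)"
    by (simp add: R.E_sum ell2_scale block_ell2[OF vw])
  also have "\<dots> = (\<lambda>y. \<Sum>l\<in>{1..<N}. if m * N = l * n then of_real (b l) * block v w N (?w l) y else 0)"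
  proof (intro ext sum.cong)
    fix y l assume l: "l \<in> {1..<N}"
    have "E {lambda_mn q r m n} (block v w N (?w l))
        = (if lambda_mn q r m n = lambda_mn q r l N then block v w N (?w l) else (\<lambda>x. 0))"
      by (rule R.eigenvector_E[OF block_ell2[OF vw] walk_block_wave[OF vw N(1)]])
    moreover have "lambda_mn q r m n = lambda_mn q r l N \<longleftrightarrow> m * N = l * n"
      using A.p_ge B.p_ge mn l by (intro lambda_mn_eq_iff) auto
    ultimately show "E {lambda_mn q r m n} (\<lambda>y. of_real (b l) * block v w N (?w l) y) y
        = (if m * N = l * n then of_real (b l) * block v w N (?w l) y else 0)"
      by (simp add: R.E_scale block_ell2[OF vw])
  qed simp
  also have "\<dots> = (\<lambda>y. if n dvd N then of_real (2 / real N * sin (real (Suc i) * (real m / real n * pi)) /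
        (ratio ^ Suc i * real q ^ i * real r ^ j)) * block v w N (wave (real m / real n * pi)) y else 0)"
  proof (cases "n dvd N")
    case True
    then obtain e where e: "N = n * e" ..
    have eq: "m * N = l * n \<longleftrightarrow> l = m * e" for l using e mn by auto
    have "m * e \<in> {1..<N}" using e mn N by (auto simp: Suc_le_eq)
    then have "(\<Sum>l\<in>{1..<N}. if m * N = l * n then of_real (b l) * block v w N (?w l) y else 0)
        = of_real (b (m * e)) * block v w N (?w (m * e)) y" for y
      by (simp add: eq sum.delta')
    moreover have angle: "real (m * e) * pi / real N = real m / real n * pi" using e N by auto
    moreover have "b (m * e) = 2 / real N * sin (real (Suc i) * (real m / real n * pi)) /
        (ratio ^ Suc i * real q ^ i * real r ^ j)"
      by (simp only: b_def angle)
    ultimately show ?thesis using True by (simp only: if_True)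
  next
    case False
    have "m * N \<noteq> l * n" for l
      using False mn(3) by (metis coprime_commute coprime_dvd_mult_right_iff dvd_triv_right)
    then show ?thesis using False by simp
  qed
  finally show ?thesis by (simp only: N_def v_def w_def)
qed

text \<open>The apexes lie above both vertices only if they are not below the confluents, and then the level
  of \<open>(z1, z2)\<close> is \<open>u1 + (Suc i - d1)\<close>. Evaluating there gives the coefficients \<open>C_coeff\<close>, also in the
  degenerate cases where this level is \<open>0\<close> or \<open>i + j + 2\<close>, because the profile vanishes at the
  ends.\<close>

lemma block_at_confluent:
  assumes conf1: "\<And>k l. A.anc k z1 = A.anc l x1 \<longleftrightarrow> (\<exists>t. k = u1 + t \<and> l = d1 + t)"
    and conf2: "\<And>k l. B.anc k z2 = B.anc l x2 \<longleftrightarrow> (\<exists>t. k = u2 + t \<and> l = d2 + t)"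
    and ud: "u1 + u2 = d1 + d2" and ends0: "g 0 = 0" "g (i + j + 2) = 0"
  shows "block (A.anc i x1) (B.anc j x2) (i + j + 2) g (z1, z2) =
    of_real (if d1 \<le> Suc i \<and> d2 \<le> Suc j then g (u1 + (Suc i - d1)) *
      (C_coeff q r (Suc i - d1) (Suc j - d2) / (real q * real r)) else 0)"
proof -
  let ?t = "\<lambda>k. g k * (A.branch (A.anc i x1) k z1 * B.branch (B.anc j x2) (i + j + 2 - k) z2)"
  let ?C = "C_coeff q r (Suc i - d1) (Suc j - d2) / (real q * real r)"
  have coeff: "(of_bool (d1 \<le> i) - 1 / real q) * (of_bool (d2 \<le> j) - 1 / real r) = ?C"
    if "d1 \<le> Suc i" "d2 \<le> Suc j"
    using that A.p_ge B.p_ge by (cases "d1 \<le> i"; cases "d2 \<le> j") (auto simp: C_coeff_def field_simps)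
  have "(\<Sum>k\<le>i + j + 2. ?t k) = (if d1 \<le> Suc i \<and> d2 \<le> Suc j then g (u1 + (Suc i - d1)) * ?C else 0)"
  proof (cases "d1 \<le> Suc i \<and> d2 \<le> Suc j")
    case True
    let ?k = "u1 + (Suc i - d1)"
    have k: "?k \<le> i + j + 2" "i + j + 2 - ?k = u2 + (Suc j - d2)" using True ud by auto
    have "?t k = (if k = ?k then g ?k * ?C else 0)" if "k \<le> i + j + 2" for k
    proof (cases "k = ?k")
      case eq: True
      show ?thesis
      proof (cases "?k = 0 \<or> ?k = i + j + 2")
        case True
        then have "g ?k = 0" using ends0 by metis
        then show ?thesis using eq by simp
      next
        case False
        then have pos: "0 < ?k" "0 < i + j + 2 - ?k" using k by linarith+
        have "A.branch (A.anc i x1) ?k z1 = of_bool (d1 \<le> i) - 1 / real q"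
          using pos(1) True by (simp only: A.branch_at_confluent[OF conf1] if_True simp_thms)
        moreover have "B.branch (B.anc j x2) (i + j + 2 - ?k) z2 = of_bool (d2 \<le> j) - 1 / real r"
          using pos(2) True k(2) by (simp only: B.branch_at_confluent[OF conf2] if_True simp_thms)
        ultimately show ?thesis using eq True by (simp only: coeff refl if_True)
      qed
    qed (simp add: A.branch_at_confluent[OF conf1])
    then have "(\<Sum>k\<le>i + j + 2. ?t k) = (\<Sum>k\<le>i + j + 2. if k = ?k then g ?k * ?C else 0)"
      by (intro sum.cong) auto
    then show ?thesis using True k by (simp add: sum.delta')
  qed (auto intro!: sum.neutral simp: A.branch_at_confluent[OF conf1] B.branch_at_confluent[OF conf2])
  then show ?thesis by (simp add: block_def)
qed

end

section \<open>Summation over all heights\<close>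

context horocyclic_product
begin

text \<open>The contribution of the block whose apexes are the \<open>i\<close>-th and the \<open>j\<close>-th ancestor of \<open>x\<close>. On the
  axes \<open>i = 0\<close> and \<open>j = 0\<close>, where there is no block, the factor \<open>sin (i * \<theta>)\<close> makes it vanish for the
  angles that occur.\<close>

definition mass :: "nat \<Rightarrow> real \<Rightarrow> nat \<Rightarrow> nat \<Rightarrow> nat \<Rightarrow> nat \<times> nat \<Rightarrow> real" where
  "mass n \<theta> u1 d1 d2 = (\<lambda>(i, j). if n dvd i + j \<and> d1 \<le> i \<and> d2 \<le> j then
     2 / real (i + j) * C_coeff q r (i - d1) (j - d2) *
     (ratio ^ (u1 + (i - d1)) / (ratio ^ i * real q ^ i * real r ^ j)) *
     sin (real i * \<theta>) * sin (real (u1 + (i - d1)) * \<theta>) else 0)"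

lemma E_piece_at_confluent:
  assumes "resolution V walk E" and x: "(x1, x2) \<in> V" and mn: "0 < m" "m < n" "coprime m n"
    and conf1: "\<And>k l. A.anc k z1 = A.anc l x1 \<longleftrightarrow> (\<exists>t. k = u1 + t \<and> l = d1 + t)"
    and conf2: "\<And>k l. B.anc k z2 = B.anc l x2 \<longleftrightarrow> (\<exists>t. k = u2 + t \<and> l = d2 + t)"
    and ud: "u1 + u2 = d1 + d2"
  shows "E {lambda_mn q r m n} (piece (x1, x2) i j) (z1, z2)
    = of_real (mass n (real m / real n * pi) u1 d1 d2 (Suc i, Suc j))"
proof (cases "n dvd i + j + 2")
  case True
  let ?\<theta> = "real m / real n * pi"
  have "wave ?\<theta> 0 = 0" "wave ?\<theta> (i + j + 2) = 0"
    using sin_multiple_eq_0[OF True] mn by (auto simp: wave_def)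
  note block = block_at_confluent[where g = "wave ?\<theta>", OF conf1 conf2 ud this]
  have "E {lambda_mn q r m n} (piece (x1, x2) i j) (z1, z2) =
      of_real (2 / real (i + j + 2) * sin (real (Suc i) * ?\<theta>) / (ratio ^ Suc i * real q ^ i * real r ^ j) *
        (if d1 \<le> Suc i \<and> d2 \<le> Suc j then wave ?\<theta> (u1 + (Suc i - d1)) *
      (C_coeff q r (Suc i - d1) (Suc j - d2) / (real q * real r)) else 0))"
    using True by (simp only: E_piece[OF assms(1) x mn] if_True fst_conv snd_conv block of_real_mult)
  also have "2 / real (i + j + 2) * sin (real (Suc i) * ?\<theta>) / (ratio ^ Suc i * real q ^ i * real r ^ j) *
        (if d1 \<le> Suc i \<and> d2 \<le> Suc j then wave ?\<theta> (u1 + (Suc i - d1)) *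
      (C_coeff q r (Suc i - d1) (Suc j - d2) / (real q * real r)) else 0)
      = mass n ?\<theta> u1 d1 d2 (Suc i, Suc j)"
    using True by (simp add: mass_def wave_def ac_simps)
  finally show ?thesis .
qed (simp add: E_piece[OF assms(1) x mn] mass_def)

lemma mass_axis:
  assumes "0 < n" "i = 0 \<or> j = 0"
  shows "mass n (real m / real n * pi) u1 d1 d2 (i, j) = 0"
  using assms sin_multiple_eq_0[of n i m] by (auto simp: mass_def)

text \<open>Apart from bounded factors, the term is \<open>q\<close> to the power \<open>- i\<close> times \<open>r\<close> to the power \<open>- j\<close>.\<close>

lemma mass_abs_summable: "(\<lambda>p. norm (mass n \<theta> u1 d1 d2 p)) summable_on UNIV"
proof -
  define M where "M = 2 * (real q * real r) * (ratio ^ u1 / ratio ^ d1)"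
  let ?g = "\<lambda>p. (1 / real q) ^ fst p * (1 / real r) ^ snd p"
  have geo: "(\<lambda>i. (1 / real a) ^ i) summable_on UNIV" if "2 \<le> a" for a
    using that by (intro summable_nonneg_imp_summable_on summable_geometric) auto
  have "?g summable_on Sigma UNIV (\<lambda>_. UNIV)"
  proof (rule summable_on_SigmaI)
    show "((\<lambda>j. ?g (i, j)) has_sum (1 / real q) ^ i * (\<Sum>\<^sub>\<infinity>j. (1 / real r) ^ j)) UNIV" for i
      using has_sum_cmult_right[OF has_sum_infsum[OF geo[OF B.p_ge]]] by simp
    show "(\<lambda>i. (1 / real q) ^ i * (\<Sum>\<^sub>\<infinity>j. (1 / real r) ^ j)) summable_on UNIV"
      by (intro summable_on_cmult_left geo A.p_ge)
  qed auto
  then have "(\<lambda>p. M * ?g p) summable_on UNIV" by (intro summable_on_cmult_right) simp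
  then show ?thesis
  proof (rule summable_on_comparison_test)
    fix p :: "nat \<times> nat"
    obtain i j where p: "p = (i, j)" by (cases p)
    show "norm (mass n \<theta> u1 d1 d2 p) \<le> M * ?g p"
    proof (cases "n dvd i + j \<and> d1 \<le> i \<and> d2 \<le> j")
      case True
      have pos: "0 < ratio ^ k" "0 < real q ^ k" "0 < real r ^ k" for k
        using ratio_pos A.p_ge B.p_ge by auto
      have "\<bar>2 / real (i + j)\<bar> \<le> 2"
        by (cases "i + j = 0") (auto simp: divide_le_eq)
      moreover have "\<bar>C_coeff q r (i - d1) (j - d2)\<bar> \<le> real q * real r"
      proof -
        define Q where "Q = real q * real r"
        have "(real q - 1) * (real r - 1) \<le> Q" unfolding Q_def
          using A.p_ge B.p_ge by (intro mult_mono) auto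
        moreover have "real r \<le> Q" "real q \<le> Q" unfolding Q_def
          using A.p_ge B.p_ge by simp_all
        moreover have "0 \<le> (real q - 1) * (real r - 1)" using A.p_ge B.p_ge by simp
        ultimately show ?thesis
          unfolding Q_def[symmetric] using A.p_ge B.p_ge by (auto simp: C_coeff_def)
      qed
      moreover have "\<bar>ratio ^ (u1 + (i - d1)) / (ratio ^ i * real q ^ i * real r ^ j)\<bar>
          = ratio ^ u1 / ratio ^ d1 * ?g p"
      proof -
        have "ratio ^ i = ratio ^ d1 * ratio ^ (i - d1)" using True by (simp flip: power_add)
        moreover have "0 < ratio ^ (u1 + (i - d1)) / (ratio ^ i * real q ^ i * real r ^ j)"
          by (intro divide_pos_pos mult_pos_pos pos)
        ultimately show ?thesis
          using ratio_pos by (simp only: abs_of_pos) (simp add: p power_add power_divide)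
      qed
      ultimately have "\<bar>2 / real (i + j)\<bar> * \<bar>C_coeff q r (i - d1) (j - d2)\<bar> *
          \<bar>ratio ^ (u1 + (i - d1)) / (ratio ^ i * real q ^ i * real r ^ j)\<bar> * \<bar>sin (real i * \<theta>)\<bar> *
          \<bar>sin (real (u1 + (i - d1)) * \<theta>)\<bar>
          \<le> 2 * (real q * real r) * (ratio ^ u1 / ratio ^ d1 * ?g p) * 1 * 1"
        using pos by (intro mult_mono) (auto intro!: mult_nonneg_nonneg divide_nonneg_nonneg simp: less_imp_le)
      then show ?thesis using True by (simp add: mass_def p M_def abs_mult)
    next
      case False
      then show ?thesis using ratio_pos by (auto simp: mass_def p M_def)
    qed
  qed simp
qed

text \<open>Absolute summability gives a sum over all pairs, and the squares identify its value.\<close>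

lemma mass_has_sum:
  assumes res: "resolution V walk E" and x: "(x1, x2) \<in> V" and z: "(z1, z2) \<in> V"
    and mn: "0 < m" "m < n" "coprime m n"
    and conf1: "\<And>k l. A.anc k z1 = A.anc l x1 \<longleftrightarrow> (\<exists>t. k = u1 + t \<and> l = d1 + t)"
    and conf2: "\<And>k l. B.anc k z2 = B.anc l x2 \<longleftrightarrow> (\<exists>t. k = u2 + t \<and> l = d2 + t)"
    and ud: "u1 + u2 = d1 + d2"
  shows "((\<lambda>p. complex_of_real (mass n (real m / real n * pi) u1 d1 d2 p)) has_sum
    spectral_measure V E (z1, z2) (x1, x2) {lambda_mn q r m n}) UNIV"
proof -
  let ?f = "\<lambda>p. complex_of_real (mass n (real m / real n * pi) u1 d1 d2 p)"
  let ?\<mu> = "spectral_measure V E (z1, z2) (x1, x2) {lambda_mn q r m n}"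
  have "(\<lambda>p. norm (?f p)) summable_on UNIV" using mass_abs_summable by simp
  then have "?f summable_on UNIV" by (rule abs_summable_summable)
  then have "(sum ?f \<longlongrightarrow> infsum ?f UNIV) (finite_subsets_at_top UNIV)"
    using has_sum_infsum has_sum_def by blast
  moreover have "filterlim (\<lambda>K. {..K} \<times> {..K}) (finite_subsets_at_top UNIV) sequentially"
    unfolding filterlim_finite_subsets_at_top
  proof (intro allI impI)
    fix X :: "(nat \<times> nat) set" assume "finite X \<and> X \<subseteq> UNIV"
    then have fin: "finite (fst ` X \<union> snd ` X)" by simp
    show "\<forall>\<^sub>F K in sequentially. finite ({..K} \<times> {..K}) \<and> X \<subseteq> {..K} \<times> {..K} \<and> {..K} \<times> {..K} \<subseteq> UNIV"
    proof (rule eventually_sequentiallyI)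
      fix K assume "Max (insert 0 (fst ` X \<union> snd ` X)) \<le> K"
      then have "\<forall>a\<in>fst ` X \<union> snd ` X. a \<le> K" using fin by simp
      then have "X \<subseteq> {..K} \<times> {..K}" by force
      then show "finite ({..K} \<times> {..K}) \<and> X \<subseteq> {..K} \<times> {..K} \<and> {..K} \<times> {..K} \<subseteq> UNIV" by simp
    qed
  qed
  ultimately have "(\<lambda>K. sum ?f ({..K} \<times> {..K})) \<longlonglongrightarrow> infsum ?f UNIV"
    by (rule filterlim_compose)
  moreover have "sum ?f ({..K} \<times> {..K})
      = (\<Sum>i<K. \<Sum>j<K. E {lambda_mn q r m n} (piece (x1, x2) i j) (z1, z2))" for K
  proof -
    have "sum ?f ({..K} \<times> {..K}) = (\<Sum>i\<le>K. \<Sum>j\<le>K. ?f (i, j))"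
      by (simp add: sum.cartesian_product)
    also have "\<dots> = (\<Sum>i<K. \<Sum>j<K. ?f (Suc i, Suc j))"
    proof -
      have "?f (0, j) = 0" "?f (i, 0) = 0" for i j
        using mass_axis[of n 0 j m u1 d1 d2] mass_axis[of n i 0 m u1 d1 d2] mn by simp_all
      then show ?thesis by (simp only: sum.atMost_shift) simp
    qed
    finally show ?thesis by (simp only: E_piece_at_confluent[OF res x mn conf1 conf2 ud])
  qed
  ultimately have "(\<lambda>K. \<Sum>i<K. \<Sum>j<K. E {lambda_mn q r m n} (piece (x1, x2) i j) (z1, z2))
      \<longlonglongrightarrow> infsum ?f UNIV" by simp
  moreover have "(\<lambda>K. \<Sum>i<K. \<Sum>j<K. E {lambda_mn q r m n} (piece (x1, x2) i j) (z1, z2)) \<longlonglongrightarrow> ?\<mu>"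
    by (rule E_delta_limit[OF res _ x z]) simp
  ultimately have "infsum ?f UNIV = ?\<mu>" by (rule LIMSEQ_unique)
  then show ?thesis using has_sum_infsum[OF \<open>?f summable_on UNIV\<close>] by simp
qed

text \<open>Only blocks above both confluents whose height is a positive multiple \<open>l n\<close> contribute; they are
  grouped by \<open>l\<close>, with \<open>k\<close> the generation of the first apex above the confluent.\<close>

lemma mass_has_sum_by_height:
  assumes sum: "((\<lambda>p. complex_of_real (mass n \<theta> u1 d1 d2 p)) has_sum \<mu>) UNIV"
    and n: "0 < n" and s: "s = d1 + d2"
  shows "((\<lambda>l. complex_of_real (\<Sum>k = 0..l * n - s. mass n \<theta> u1 d1 d2 (d1 + k, d2 + (l * n - s - k))))
    has_sum \<mu>) {max 1 (nat \<lceil>real s / real n\<rceil>)..}"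
proof -
  let ?f = "\<lambda>p. complex_of_real (mass n \<theta> u1 d1 d2 p)"
  let ?L = "{max 1 (nat \<lceil>real s / real n\<rceil>)..}"
  let ?I = "Sigma ?L (\<lambda>l. {0..l * n - s})"
  let ?\<phi> = "\<lambda>(l, k). (d1 + k, d2 + (l * n - s - k))"
  have L: "l \<in> ?L \<longleftrightarrow> 1 \<le> l \<and> s \<le> l * n" for l
  proof -
    have "nat \<lceil>real s / real n\<rceil> \<le> l \<longleftrightarrow> real s / real n \<le> real l" by linarith
    also have "\<dots> \<longleftrightarrow> real s \<le> real (l * n)" using n by (simp add: field_simps)
    also have "\<dots> \<longleftrightarrow> s \<le> l * n" by (simp only: of_nat_le_iff)
    finally show ?thesis by auto
  qed
  have "inj_on ?\<phi> ?I"
  proof (rule inj_onI)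
    fix p p' assume p: "p \<in> ?I" "p' \<in> ?I" "?\<phi> p = ?\<phi> p'"
    obtain l k l' k' where eq_p: "p = (l, k)" "p' = (l', k')" by (cases p; cases p')
    have eq: "d1 + k = d1 + k'" "d2 + (l * n - s - k) = d2 + (l' * n - s - k')"
      using p(3) unfolding eq_p by (simp_all only: prod.case prod.inject)
    have "l \<in> ?L" "k \<in> {0..l * n - s}" "l' \<in> ?L" "k' \<in> {0..l' * n - s}"
      using p(1,2) unfolding eq_p by blast+
    then have "s \<le> l * n" "s \<le> l' * n" "k \<le> l * n - s" "k' \<le> l' * n - s" using L by auto
    then have "l * n = l' * n" using eq by linarith
    then show "p = p'" using n eq by (simp add: eq_p)
  qed
  moreover have "(?f has_sum \<mu>) (?\<phi> ` ?I)"
  proof (rule has_sum_cong_neutral[THEN iffD1, OF _ _ _ sum])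
    fix p assume p: "p \<in> UNIV - ?\<phi> ` ?I"
    obtain i j where ij: "p = (i, j)" by (cases p)
    show "?f p = 0"
    proof (rule ccontr)
      assume "?f p \<noteq> 0"
      then have nz: "n dvd i + j" "d1 \<le> i" "d2 \<le> j" "i + j \<noteq> 0"
        by (auto simp: ij mass_def split: if_splits)
      then obtain l where l: "i + j = l * n" by (metis dvd_def mult.commute)
      then have "l \<in> ?L" unfolding L using nz s by (cases l) auto
      moreover have "i - d1 \<le> l * n - s" "?\<phi> (l, i - d1) = p"
        using nz s by (auto simp: ij l[symmetric])
      ultimately have "p \<in> ?\<phi> ` ?I" by (intro image_eqI[of _ _ "(l, i - d1)"]) auto
      then show False using p by blast
    qed
  qed auto
  ultimately have "((?f \<circ> ?\<phi>) has_sum \<mu>) ?I" using has_sum_reindex by blast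
  then show ?thesis
  proof (rule has_sum_SigmaD)
    fix l
    show "((\<lambda>k. (?f \<circ> ?\<phi>) (l, k)) has_sum
        complex_of_real (\<Sum>k = 0..l * n - s. mass n \<theta> u1 d1 d2 (d1 + k, d2 + (l * n - s - k)))) {0..l * n - s}"
      by (rule has_sum_finiteI) auto
  qed
qed

text \<open>Both sides contain the same power of \<open>r / q\<close>, since \<open>ratio ^ 2 = r / q\<close>.\<close>

lemma mass_eq:
  assumes "N = d1 + k + (d2 + k2)" "n dvd N"
  shows "mass n \<theta> u1 d1 d2 (d1 + k, d2 + k2) =
    2 * real r powr (- real N) / real N * (C_coeff q r k k2 *
      (real r / real q) powr (real k + real (d1 + u1) / 2) * sin (real (k + u1) * \<theta>) * sin (real (k + d1) * \<theta>))"
proof -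
  have pos: "0 < ratio" "0 < real q" "0 < real r" using ratio_pos A.p_ge B.p_ge by auto
  have "(real r / real q) powr (real k + real (d1 + u1) / 2) = (real r / real q) ^ k * ratio ^ (d1 + u1)"
  proof -
    have "ratio = (real r / real q) powr (1 / 2)"
      using pos by (simp add: ratio_def powr_half_sqrt)
    then have "ratio ^ (d1 + u1) = (real r / real q) powr (real (d1 + u1) / 2)"
      using pos by (simp add: powr_realpow[symmetric] powr_powr)
    then show ?thesis using pos by (simp add: powr_add powr_realpow)
  qed
  moreover have "real r powr (- real N) = 1 / real r ^ N"
    using pos by (simp add: powr_minus powr_realpow inverse_eq_divide)
  moreover have "ratio ^ (u1 + k) / (ratio ^ (d1 + k) * real q ^ (d1 + k) * real r ^ (d2 + k2))
      = 1 / real r ^ N * ((real r / real q) ^ k * ratio ^ (d1 + u1))"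
  proof -
    have "ratio ^ d1 * ratio ^ d1 = (real r / real q) ^ d1"
      by (simp only: power_mult_distrib[symmetric] ratio_sq)
    then have "ratio ^ d1 * ratio ^ d1 * real q ^ d1 = real r ^ d1"
      using pos by (simp add: power_divide)
    then show ?thesis using pos by (simp add: assms(1) power_add power_divide field_simps)
  qed
  ultimately show ?thesis using assms by (simp add: mass_def ac_simps)
qed

end

theorem proposition4p5:
  fixes q r m n :: nat
    and T1 :: "'a \<Rightarrow> 'a \<Rightarrow> bool" and T2 :: "'b \<Rightarrow> 'b \<Rightarrow> bool"
    and o1 x1 :: 'a and o2 x2 :: 'b
    and \<omega>1 :: "(nat \<Rightarrow> 'a) set" and \<omega>2 :: "(nat \<Rightarrow> 'b) set"
    and V :: "('a \<times> 'b) set"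
    and E :: "real set \<Rightarrow> ('a \<times> 'b \<Rightarrow> complex) \<Rightarrow> ('a \<times> 'b \<Rightarrow> complex)"
    and u1 u2 d1 s :: nat
  assumes "q \<ge> 2" and "r \<ge> 2"
    and "homogeneous_tree q T1" and "\<omega>1 \<in> ends T1"
    and "homogeneous_tree r T2" and "\<omega>2 \<in> ends T2"
    and "V = DL_verts T1 o1 \<omega>1 T2 o2 \<omega>2"
    and "resolution_of_identity V (srw_op V (DL_adj T1 T2) (q + r)) E"
    and "(x1, x2) \<in> V"
    and "u1 = up T1 o1 \<omega>1 x1" and "u2 = up T2 o2 \<omega>2 x2"
    and "d1 = down T1 o1 \<omega>1 x1" and "s = u1 + u2"
    and "1 \<le> m" and "m < n" and "coprime m n"
  shows "((\<lambda>l. complex_of_real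
             (2 * real r powr (- real (l * n)) / real (l * n) *
              (\<Sum>k = 0..l * n - s.
                 C_coeff q r k (l * n - s - k) *
                 (real r / real q) powr (real k + real (gdist T1 x1 o1) / 2) *
                 sin (real (k + u1) * (real m / real n) * pi) *
                 sin (real (k + d1) * (real m / real n) * pi))))
          has_sum spectral_measure V E (o1, o2) (x1, x2) {lambda_mn q r m n})
         {max 1 (nat \<lceil>real s / real n\<rceil>)..}"
proof -
  obtain par1 h1 where G1: "genealogy q par1 h1"
    and T1: "\<And>x y. T1 x y \<longleftrightarrow> par1 x = y \<or> par1 y = x"
    and conf1: "\<And>x y k l. (par1 ^^ k) x = (par1 ^^ l) y \<longleftrightarrow>
      (\<exists>t. k = down T1 y \<omega>1 x + t \<and> l = up T1 y \<omega>1 x + t)"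
    and dist1: "\<And>x y. gdist T1 x y = down T1 y \<omega>1 x + up T1 y \<omega>1 x"
    and bus1: "\<And>x y. busemann T1 y \<omega>1 x = h1 x - h1 y"
    by (rule homogeneous_tree_genealogy[OF assms(3,1,4)]) (rule that)
  obtain par2 h2 where G2: "genealogy r par2 h2"
    and T2: "\<And>x y. T2 x y \<longleftrightarrow> par2 x = y \<or> par2 y = x"
    and conf2: "\<And>x y k l. (par2 ^^ k) x = (par2 ^^ l) y \<longleftrightarrow>
      (\<exists>t. k = down T2 y \<omega>2 x + t \<and> l = up T2 y \<omega>2 x + t)"
    and dist2: "\<And>x y. gdist T2 x y = down T2 y \<omega>2 x + up T2 y \<omega>2 x"
    and bus2: "\<And>x y. busemann T2 y \<omega>2 x = h2 x - h2 y"
    by (rule homogeneous_tree_genealogy[OF assms(5,2,6)]) (rule that)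
  interpret H: horocyclic_product q par1 h1 r par2 h2 "h1 o1 + h2 o2"
    using G1 G2 by (rule horocyclic_product.intro)
  have V: "V = H.V"
    by (auto simp: assms(7) DL_verts_def H.V_def bus1 bus2)
  have walk: "srw_op V (DL_adj T1 T2) (q + r) = H.walk"
    unfolding V by (rule H.srw_op_eq_walk[OF T1 T2])
  have res: "resolution H.V H.walk E"
  proof
    show "resolution_of_identity H.V H.walk E" using assms(8) by (simp add: V[symmetric] walk)
    show "H.walk f \<in> ell2 H.V" if "f \<in> ell2 H.V" for f
    proof -
      have deg1: "finite {y. T1 x y} \<and> card {y. T1 x y} = q + 1" for x
        using assms(3) by (auto simp: homogeneous_tree_def intro: card_ge_0_finite)
      have deg2: "finite {y. T2 x y} \<and> card {y. T2 x y} = r + 1" for x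
        using assms(5) by (auto simp: homogeneous_tree_def intro: card_ge_0_finite)
      have nbrs: "{y. DL_adj T1 T2 x y} = {y. T1 (fst x) y} \<times> {y. T2 (snd x) y}" for x
        by (auto simp: DL_adj_def)
      have "srw_op V (DL_adj T1 T2) (q + r) f \<in> ell2 V"
      proof (rule srw_op_ell2[where D = "(q + 1) * (r + 1)"])
        show "DL_adj T1 T2 x y \<Longrightarrow> DL_adj T1 T2 y x" for x y by (auto simp: DL_adj_def T1 T2)
        show "finite {y. DL_adj T1 T2 x y}" "card {y. DL_adj T1 T2 x y} \<le> (q + 1) * (r + 1)" for x
          unfolding nbrs card_cartesian_product using deg1 deg2 by auto
        show "f \<in> ell2 V" using that by (simp add: V)
      qed
      then show ?thesis unfolding walk by (simp add: V)
    qed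
  qed (rule H.walk_add H.walk_scale)+
  define d2 where "d2 = down T2 o2 \<omega>2 x2"
  have x: "(x1, x2) \<in> H.V" using assms(9) V by simp
  have o: "(o1, o2) \<in> H.V" by (simp add: H.V_def)
  have ud: "u1 + u2 = d1 + d2"
    using assms(9) unfolding assms(7,10,11,12) d2_def by (auto simp: DL_verts_def busemann_def)
  have c1: "(par1 ^^ k) o1 = (par1 ^^ l) x1 \<longleftrightarrow> (\<exists>t. k = u1 + t \<and> l = d1 + t)" for k l
    using conf1[of l x1 k o1] unfolding assms(10,12) by (metis (no_types))
  have c2: "(par2 ^^ k) o2 = (par2 ^^ l) x2 \<longleftrightarrow> (\<exists>t. k = u2 + t \<and> l = d2 + t)" for k l
    using conf2[of l x2 k o2] unfolding assms(11) d2_def by (metis (no_types))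
  have "0 < m" "0 < n" using assms by auto
  have s: "s = d1 + d2" using ud assms(13) by simp
  let ?\<theta> = "real m / real n * pi"
  let ?L = "{max 1 (nat \<lceil>real s / real n\<rceil>)..}"
  have "((\<lambda>l. complex_of_real (\<Sum>k = 0..l * n - s. H.mass n ?\<theta> u1 d1 d2 (d1 + k, d2 + (l * n - s - k))))
    has_sum spectral_measure V E (o1, o2) (x1, x2) {lambda_mn q r m n}) ?L"
    unfolding V
    by (rule H.mass_has_sum_by_height[OF H.mass_has_sum[OF res x o \<open>0 < m\<close> assms(15,16) c1 c2 ud] \<open>0 < n\<close> s])
  also have "?this \<longleftrightarrow> ?thesis"
  proof (rule has_sum_cong)
    fix l assume "l \<in> ?L"
    then have "nat \<lceil>real s / real n\<rceil> \<le> l" by simp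
    then have "real s / real n \<le> real l" by linarith
    then have "real s \<le> real (l * n)" using \<open>0 < n\<close> by (simp add: field_simps)
    then have l: "s \<le> l * n" by (simp only: of_nat_le_iff)
    have "(\<Sum>k = 0..l * n - s. H.mass n ?\<theta> u1 d1 d2 (d1 + k, d2 + (l * n - s - k)))
        = (\<Sum>k = 0..l * n - s. 2 * real r powr (- real (l * n)) / real (l * n) *
            (C_coeff q r k (l * n - s - k) *
                 (real r / real q) powr (real k + real (gdist T1 x1 o1) / 2) *
                 sin (real (k + u1) * ?\<theta>) * sin (real (k + d1) * ?\<theta>)))"
    proof (rule sum.cong)
      fix k assume "k \<in> {0..l * n - s}"
      then have "l * n = d1 + k + (d2 + (l * n - s - k))" using l s by auto
      moreover have "gdist T1 x1 o1 = d1 + u1" unfolding assms(10,12) by (rule dist1)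
      ultimately show "H.mass n ?\<theta> u1 d1 d2 (d1 + k, d2 + (l * n - s - k)) =
          2 * real r powr (- real (l * n)) / real (l * n) *
            (C_coeff q r k (l * n - s - k) *
                 (real r / real q) powr (real k + real (gdist T1 x1 o1) / 2) *
                 sin (real (k + u1) * ?\<theta>) * sin (real (k + d1) * ?\<theta>))"
        using H.mass_eq[of "l * n" d1 k d2 "l * n - s - k" n ?\<theta> u1] by (simp only: dvd_triv_right)
    qed simp
    then show "complex_of_real (\<Sum>k = 0..l * n - s. H.mass n ?\<theta> u1 d1 d2 (d1 + k, d2 + (l * n - s - k))) =
      complex_of_real (2 * real r powr (- real (l * n)) / real (l * n) *
              (\<Sum>k = 0..l * n - s.
                 C_coeff q r k (l * n - s - k) *
                 (real r / real q) powr (real k + real (gdist T1 x1 o1) / 2) *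
                 sin (real (k + u1) * (real m / real n) * pi) *
                 sin (real (k + d1) * (real m / real n) * pi)))"
      by (simp only: sum_distrib_left mult.assoc)
  qed
  finally show ?thesis .
qed

end
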